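(* Let $f:\mathbb{C}^2\to\mathbb{C}^2$ be the deltoid map $f(x,y)=(y^2-2x,\,x^2-2y)$. The iterated monodromy group $\mathrm{IMG}(f)$ is isomorphic to the affine Coxeter group $\tilde A_2$.
   Context: Let $\mathcal{D}\subset\mathbb{C}^2$ be the deltoid, i.e. the image of $\gamma(t)=\left(2t+\frac1{t^2},\frac2t+t^2\right)$, $t\in\mathbb{C}\setminus\{0\}$; equivalently, the affine curve $x^2y^2-4(x^3+y^3)+18xy-27=0$. The critical locus of $f$ in $\mathbb{C}^2$ is $\mathcal{C}=\{xy=1\}$, and $f(\mathcal{C})=\mathcal{D}$, $f(\mathcal{D})=\mathcal{D}$. Set $\mathcal{X}=\mathbb{C}^2\setminus\mathcal{D}$, $\mathcal{X}_n=f^{-n}(\mathcal{X})$ for $n\ge1$ (so $\mathcal{X}_1=\mathcal{X}\setminus\mathcal{C}$), and $\mathbf{x}_0=(0,0)\in\mathcal{X}$. For each $n\ge1$, $f^n|_{\mathcal{X}_n}:\mathcal{X}_n\to\mathcal{X}$ is a covering map, where $f^n$ is the $n$-fold composition. The monodromy homomorphism $\mu_{f^n}$ from $\pi_1(\mathcal{X},\mathbf{x}_0)$ to the symmetric group on $f^{-n}(\mathbf{x}_0)$ is defined by: for $[\eta]\in\pi_1(\mathcal{X},\mathbf{x}_0)$ and $\mathbf{y}\in f^{-n}(\mathbf{x}_0)$, $[\eta]\cdot\mathbf{y}$ is the endpoint of the lift of $\eta$ by $f^n$ starting at $\mathbf{y}$. Let $\kappa_f=\bigcap_{n\ge1}\ker\mu_{f^n}$,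 a normal subgroup of $\pi_1(\mathcal{X},\mathbf{x}_0)$. The iterated monodromy group is $\mathrm{IMG}(f)=\pi_1(\mathcal{X},\mathbf{x}_0)/\kappa_f$. The affine Coxeter group $\tilde A_2$ is the group generated by reflections across the sides of an equilateral triangle in the Euclidean plane; it has presentation $\tilde A_2=\langle g_1,g_2,g_3\mid \forall k\ g_k^2=1,\ \forall j\,\forall k\ (g_jg_k)^3=1\rangle$. *)

theory Defs
  imports
    "HOL-Analysis.Analysis"
    "HOL-Algebra.Bij"
    "HOL-Algebra.Coset"
    "HOL-Algebra.Generated_Groups"
begin

definition based_loops :: "'a::topological_space set \<Rightarrow> 'a \<Rightarrow> (real \<Rightarrow> 'a) set"
  where "based_loops S x =
    {p. path p \<and> path_image p \<subseteq> S \<and> pathstart p = x \<and> pathfinish p = x}"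

definition loop_homotopy :: "'a::topological_space set \<Rightarrow> 'a \<Rightarrow> ((real \<Rightarrow> 'a) \<times> (real \<Rightarrow> 'a)) set"
  where "loop_homotopy S x =
    {(p, q). p \<in> based_loops S x \<and> q \<in> based_loops S x \<and> homotopic_paths S p q}"

text \<open>
  The product of the classes of p and q is the class of the loop that runs through q first and
  through p afterwards. With this convention the monodromy action below, in which loops act from
  the left, is a homomorphism into the symmetric group with functional composition.
\<close>

definition fundamental_group :: "'a::topological_space set \<Rightarrow> 'a \<Rightarrow> (real \<Rightarrow> 'a) set monoid"
  where "fundamental_group S x =
    \<lparr>carrier = based_loops S x // loop_homotopy S x,
     mult = (\<lambda>c d. \<Union>p\<in>c. \<Union>q\<in>d. loop_homotopy S x `` {q +++ p}),
     one = loop_homotopy S x `` {\<lambda>_. x}\<rparr>"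

text \<open>
  The monodromy action of a covering \<^term>\<open>g\<close> from \<^term>\<open>g -` S\<close> onto \<^term>\<open>S\<close>: a class of loops
  sends a point of the fibre over the base point to the endpoint of the lift starting there.
\<close>

definition monodromy ::
    "('a::topological_space \<Rightarrow> 'b::topological_space) \<Rightarrow> 'b set \<Rightarrow> 'b \<Rightarrow> (real \<Rightarrow> 'b) set \<Rightarrow> 'a \<Rightarrow> 'a"
  where "monodromy g S x c =
    (\<lambda>y \<in> g -` {x}. THE z. \<exists>\<eta>\<in>c. \<exists>l. path l \<and> path_image l \<subseteq> g -` S \<and>
       (\<forall>t\<in>{0..1}. g (l t) = \<eta> t) \<and> pathstart l = y \<and> pathfinish l = z)"

definition monodromy_kernel :: "('a::topological_space \<Rightarrow> 'a) \<Rightarrow> 'a set \<Rightarrow> 'a \<Rightarrow> (real \<Rightarrow> 'a) set set"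
  where "monodromy_kernel f S x =
    (\<Inter>n\<in>{1..}. kernel (fundamental_group S x) (BijGroup ((f ^^ n) -` {x})) (monodromy (f ^^ n) S x))"

definition iterated_monodromy_group ::
    "('a::topological_space \<Rightarrow> 'a) \<Rightarrow> 'a set \<Rightarrow> 'a \<Rightarrow> (real \<Rightarrow> 'a) set set monoid"
  where "iterated_monodromy_group f S x = fundamental_group S x Mod monodromy_kernel f S x"

definition deltoid_map :: "complex \<times> complex \<Rightarrow> complex \<times> complex"
  where "deltoid_map = (\<lambda>(x, y). (y\<^sup>2 - 2 * x, x\<^sup>2 - 2 * y))"

definition deltoid :: "(complex \<times> complex) set"
  where "deltoid = (\<lambda>t. (2 * t + 1 / t\<^sup>2, 2 / t + t\<^sup>2)) ` (UNIV - {0})"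

definition reflection_across :: "'a::euclidean_space set \<Rightarrow> 'a \<Rightarrow> 'a"
  where "reflection_across L z = 2 *\<^sub>R closest_point L z - z"

text \<open>
  The group generated by the reflections across the side lines of the triangle with vertices
  a, b and c, as a group of transformations of the plane.
\<close>

definition triangle_reflection_group :: "real^2 \<Rightarrow> real^2 \<Rightarrow> real^2 \<Rightarrow> (real^2 \<Rightarrow> real^2) monoid"
  where "triangle_reflection_group a b c =
    subgroup_generated (BijGroup UNIV)
      {reflection_across (affine hull {a, b}),
       reflection_across (affine hull {b, c}),
       reflection_across (affine hull {c, a})}"

definition equilateral :: "'a::metric_space \<Rightarrow> 'a \<Rightarrow> 'a \<Rightarrow> bool"
  where "equilateral a b c \<longleftrightarrow> a \<noteq> b \<and> dist a b = dist b c \<and> dist b c = dist c a"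

lemma reflection_across_involution:
  assumes "affine L" "closed L" "L \<noteq> {}"
  shows "reflection_across L (reflection_across L z) = z"
proof -
  define p where "p = closest_point L z"
  have pL: "p \<in> L"
    unfolding p_def by (rule closest_point_in_set[OF assms(2,3)])
  have "dist (2 *\<^sub>R p - z) p \<le> dist (2 *\<^sub>R p - z) y" if "y \<in> L" for y
  proof -
    have "2 *\<^sub>R p + (-1) *\<^sub>R y \<in> L"
      by (rule mem_affine[OF assms(1) pL that]) simp
    then have "dist z p \<le> dist z (2 *\<^sub>R p - y)"
      using closest_point_le[OF assms(2)] by (simp add: p_def)
    then show ?thesis
      by (simp add: dist_norm scaleR_2 algebra_simps norm_minus_commute)
  qed
  then have "p = closest_point L (2 *\<^sub>R p - z)"
    using closest_point_unique[OF affine_imp_convex[OF assms(1)] assms(2) pL] by blast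
  then show ?thesis
    unfolding reflection_across_def p_def[symmetric] by simp
qed

lemma reflection_across_in_BijGroup:
  assumes "affine L" "closed L" "L \<noteq> {}"
  shows "reflection_across L \<in> carrier (BijGroup UNIV)"
  using reflection_across_involution[OF assms]
  by (auto simp: BijGroup_def Bij_def intro!: o_bij[of "reflection_across L"])

end

theory Submission
  imports Defs "HOL-Computational_Algebra.Fundamental_Theorem_Algebra"
begin

text \<open>
  Writing points of the plane as (u + v + w, uv + vw + wu) with uvw = 1, the deltoid map becomes
  (u, v, w) \<mapsto> (1/u^2, 1/v^2, 1/w^2), and the deltoid is the locus where two of u, v, w agree.
  With u = exp (2 \<pi> i x), v = exp (2 \<pi> i y), w = exp (2 \<pi> i (- x - y)), the complement of the deltoid
  is the quotient of the complement of an arrangement of complex lines by the free action of the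
  affine Weyl group of type A2 (permutations and integral translations), and the map lifts to
  multiplication by - 2. The lift of a loop from a fixed base point determines an element g of this
  group, and the monodromy of the n-th iterate is trivial iff every conjugate of g has translation
  part divisible by (- 2)^n. For all n together this forces g = 1. Every g occurs, because half
  turns around the three fixed lines of the simple reflections realise generators. Finally the group
  acts on the real plane in barycentric coordinates as the reflection group of a triangle.
\<close>

section \<open>Coverings from group actions\<close>

text \<open>Write p for \<open>torus_param\<close> and z0 for the base point
  \<open>(1 / 3, 0)\<close>. The points over (0, 0) under the n-th iterate are p (k z0 / (-2)^n)
  with k in \<open>affine_weyl\<close>; a loop whose lift through p ends at h z0 moves this point to
  p (k h z0 / (-2)^n). The two agree iff k h z0 = \<sigma> (k z0) + (-2)^n v for a permutation
  \<sigma> and an integral v, and freeness of the action turns this into a condition on k h k^-1: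
  this is where conjugates and divisibility come from. Zero is the only lattice vector divisible by
  all powers of 2, so h is linear; conjugating h by the translation by u gives the translation part
  u - h u, so h fixes the lattice. The complement of the lines is not simply connected, so
  \<open>deck\<close> has a kernel, and the theorem amounts to this kernel being the intersection of
  the monodromy kernels. In the real plane the reflection lines separate the chambers; in C^2 the
  complex lines have real codimension two, which leaves room for the half turns.\<close>

lemma covering_space_of_action:
  fixes p :: "'a::euclidean_space \<Rightarrow> 'b::euclidean_space"
  assumes dim: "DIM('b) \<le> DIM('a)" and opS: "open S" and contp: "continuous_on S p"
    and cont: "\<And>g. g \<in> \<Gamma> \<Longrightarrow> continuous_on S g"
    and maps: "\<And>g z. g \<in> \<Gamma> \<Longrightarrow> z \<in> S \<Longrightarrow> g z \<in> S"
    and comp: "\<And>g h. g \<in> \<Gamma> \<Longrightarrow> h \<in> \<Gamma> \<Longrightarrow> g \<circ> h \<in> \<Gamma>"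
    and inverse: "\<And>g. g \<in> \<Gamma> \<Longrightarrow> \<exists>h\<in>\<Gamma>. h \<circ> g = id \<and> g \<circ> h = id"
    and fibre: "\<And>z w. z \<in> S \<Longrightarrow> w \<in> S \<Longrightarrow> p z = p w \<longleftrightarrow> (\<exists>g\<in>\<Gamma>. w = g z)"
    and wandering: "\<And>z. z \<in> S \<Longrightarrow>
      \<exists>U. open U \<and> z \<in> U \<and> U \<subseteq> S \<and> (\<forall>g\<in>\<Gamma>. \<forall>w\<in>U. g w \<in> U \<longrightarrow> g = id)"
  shows "covering_space S p (p ` S)"
proof
  show "continuous_on S p" by (rule contp)
  show "p ` S = p ` S" ..
  fix x assume "x \<in> p ` S"
  then obtain z where z: "z \<in> S" "x = p z" by auto
  obtain U where U: "open U" "z \<in> U" "U \<subseteq> S"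
    and wand: "\<And>g w. g \<in> \<Gamma> \<Longrightarrow> w \<in> U \<Longrightarrow> g w \<in> U \<Longrightarrow> g = id"
    using wandering[OF z(1)] by blast
  have pg: "p (g w) = p w" if "g \<in> \<Gamma>" "w \<in> S" for g w
    using fibre[OF that(2) maps[OF that]] that by auto
  have injU: "inj_on p U"
  proof (rule inj_onI)
    fix w w' assume *: "w \<in> U" "w' \<in> U" "p w = p w'"
    then obtain g where "g \<in> \<Gamma>" "w' = g w"
      using fibre[of w w'] U(3) by blast
    then show "w = w'"
      using wand[of g w] * by simp
  qed
  have inj: "inj_on p (g ` U)" if "g \<in> \<Gamma>" for g
    using injU pg[OF that] U(3) by (auto simp: inj_on_def subset_iff)
  have im: "p ` g ` U = p ` U" if "g \<in> \<Gamma>" for g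
    using pg[OF that] U(3) by (auto simp: image_image subset_iff)
  have opg: "open (g ` U)" if g: "g \<in> \<Gamma>" for g
  proof -
    obtain h where h: "h \<in> \<Gamma>" "h \<circ> g = id" "g \<circ> h = id"
      using inverse[OF g] by blast
    have 1: "h (g x) = x" "g (h x) = x" for x
      using h(2,3) by (metis comp_apply id_apply)+
    have "g ` U = S \<inter> h -` U"
    proof
      show "g ` U \<subseteq> S \<inter> h -` U"
        using maps[OF g] U(3) 1 by auto
      show "S \<inter> h -` U \<subseteq> g ` U"
      proof
        fix x assume "x \<in> S \<inter> h -` U"
        then have "h x \<in> U" by simp
        then show "x \<in> g ` U"
          using 1(2)[of x] by (metis image_eqI)
      qed
    qed
    then show ?thesis
      using continuous_open_preimage[OF cont[OF h(1)] opS U(1)] by simp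
  qed
  have sub: "g ` U \<subseteq> S" if "g \<in> \<Gamma>" for g
    using maps[OF that] U(3) by auto
  \<comment> \<open>Invariance of domain makes the injective map open, which is where the inequality
    of dimensions enters.\<close>
  have openT: "open (p ` U)"
    by (rule invariance_of_domain_gen[OF U(1) continuous_on_subset[OF contp U(3)] injU dim])
  have "\<exists>T. x \<in> T \<and> openin (top_of_set (p ` S)) T \<and>
        (\<exists>v. \<Union>v = S \<inter> p -` T \<and> (\<forall>u\<in>v. openin (top_of_set S) u) \<and>
             pairwise disjnt v \<and> (\<forall>u\<in>v. \<exists>q. homeomorphism u T p q))"
  \<comment> \<open>The sheets over the image of \<open>U\<close> are its translates; two translates
    that meet come from the same group element by \<open>wand\<close>.\<close>
  proof (intro exI[of _ "p ` U"] exI[of _ "(\<lambda>g. g ` U) ` \<Gamma>"] conjI ballI)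
    show "x \<in> p ` U" using z U by auto
    show "openin (top_of_set (p ` S)) (p ` U)"
      using openT U(3) by (metis image_mono inf.absorb_iff2 openin_open)
    show "\<Union> ((\<lambda>g. g ` U) ` \<Gamma>) = S \<inter> p -` p ` U"
    proof (intro equalityI subsetI)
      fix y assume "y \<in> \<Union> ((\<lambda>g. g ` U) ` \<Gamma>)"
      then show "y \<in> S \<inter> p -` p ` U"
        using sub im by (auto simp: subset_iff image_iff) blast+
    next
      fix y assume y: "y \<in> S \<inter> p -` p ` U"
      then obtain u where u: "u \<in> U" "p u = p y" by auto
      then obtain g where "g \<in> \<Gamma>" "y = g u"
        using fibre[of u y] U(3) y by blast
      then show "y \<in> \<Union> ((\<lambda>g. g ` U) ` \<Gamma>)"
        using u by blast
    qed
    show "openin (top_of_set S) u" if "u \<in> (\<lambda>g. g ` U) ` \<Gamma>" for u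
      using that opg sub opS by (auto simp: openin_open_eq)
    show "pairwise disjnt ((\<lambda>g. g ` U) ` \<Gamma>)"
    proof (rule pairwiseI, clarify)
      fix g g' assume *: "g \<in> \<Gamma>" "g' \<in> \<Gamma>" "g ` U \<noteq> g' ` U"
      obtain h where h: "h \<in> \<Gamma>" "h \<circ> g' = id" "g' \<circ> h = id"
        using inverse[OF *(2)] by blast
      show "disjnt (g ` U) (g' ` U)"
        unfolding disjnt_iff
      proof (intro allI notI, elim conjE imageE)
        fix y u u' assume y: "u \<in> U" "u' \<in> U" "y = g u" "y = g' u'"
        then have "(h \<circ> g) u = u'"
          using h(2) by (metis comp_apply id_apply)
        then have "h \<circ> g = id"
          using wand[OF comp[OF h(1) *(1)]] y by simp
        then have "g = g'"
          using h(3) by (metis comp_assoc comp_id id_comp)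
        then show False using *(3) by simp
      qed
    qed
    show "\<exists>q. homeomorphism u (p ` U) p q" if u: "u \<in> (\<lambda>g. g ` U) ` \<Gamma>" for u
    proof -
      obtain g where g: "g \<in> \<Gamma>" "u = g ` U" using u by blast
      then show ?thesis
        using invariance_of_domain_homeomorphism
            [OF opg[OF g(1)] continuous_on_subset[OF contp sub[OF g(1)]] dim inj[OF g(1)]]
        by (metis g im)
    qed
  qed
  then show "\<exists>T. x \<in> T \<and> openin (top_of_set (p ` S)) T \<and>
        (\<exists>v. \<Union>v = S \<inter> p -` T \<and> (\<forall>u\<in>v. openin (top_of_set S) u) \<and>
             pairwise disjnt v \<and> (\<forall>u\<in>v. Ex (homeomorphism u T p)))" by simp
qed

section \<open>The fundamental group\<close>

lemma based_loops_join:
  "p \<in> based_loops X x \<Longrightarrow> q \<in> based_loops X x \<Longrightarrow> p +++ q \<in> based_loops X x"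
  using path_image_join_subset[of p q] by (auto simp: based_loops_def)

lemma based_loops_reversepath: "p \<in> based_loops X x \<Longrightarrow> reversepath p \<in> based_loops X x"
  by (auto simp: based_loops_def)

lemma based_loops_const: "x \<in> X \<Longrightarrow> linepath x x \<in> based_loops X x"
  by (auto simp: based_loops_def)

lemma const_eq_linepath: "(\<lambda>_. x) = linepath x x"
  by (auto simp: linepath_def algebra_simps)

definition loop_class :: "'a::topological_space set \<Rightarrow> 'a \<Rightarrow> (real \<Rightarrow> 'a) \<Rightarrow> (real \<Rightarrow> 'a) set"
  where "loop_class X x p = loop_homotopy X x `` {p}"

lemma mem_loop_class:
  "q \<in> loop_class X x p \<longleftrightarrow> p \<in> based_loops X x \<and> q \<in> based_loops X x \<and> homotopic_paths X p q"
  by (auto simp: loop_class_def loop_homotopy_def)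

lemma loop_class_self: "p \<in> based_loops X x \<Longrightarrow> p \<in> loop_class X x p"
  by (auto simp: mem_loop_class) (auto simp: based_loops_def)

lemma loop_class_eqI:
  assumes "p \<in> based_loops X x" "q \<in> based_loops X x" "homotopic_paths X p q"
  shows "loop_class X x p = loop_class X x q"
  using assms by (auto simp: mem_loop_class set_eq_iff)
    (meson homotopic_paths_sym homotopic_paths_trans)+

lemma carrier_fundamental_group:
  "carrier (fundamental_group X x) = loop_class X x ` based_loops X x"
  by (auto simp: fundamental_group_def loop_class_def quotient_def)

lemma one_fundamental_group:
  "one (fundamental_group X x) = loop_class X x (linepath x x)"
  by (simp add: fundamental_group_def loop_class_def const_eq_linepath)

lemma mult_fundamental_group:
  assumes "p \<in> based_loops X x" "q \<in> based_loops X x"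
  shows "loop_class X x p \<otimes>\<^bsub>fundamental_group X x\<^esub> loop_class X x q = loop_class X x (q +++ p)"
proof -
  \<comment> \<open>All representatives give the same class, so the double union in the product is a
    union of equal sets.\<close>
  have *: "loop_homotopy X x `` {q' +++ p'} = loop_class X x (q +++ p)"
    if "p' \<in> loop_class X x p" "q' \<in> loop_class X x q" for p' q'
    unfolding loop_class_def[symmetric]
  proof (rule loop_class_eqI)
    have "p' \<in> based_loops X x" "q' \<in> based_loops X x"
      "homotopic_paths X p' p" "homotopic_paths X q' q"
      using that by (auto simp: mem_loop_class homotopic_paths_sym)
    then show "q' +++ p' \<in> based_loops X x" "homotopic_paths X (q' +++ p') (q +++ p)"
      by (auto intro!: based_loops_join homotopic_paths_join) (auto simp: based_loops_def)
  qed (auto intro: based_loops_join assms)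
  have "loop_class X x p \<otimes>\<^bsub>fundamental_group X x\<^esub> loop_class X x q =
     (\<Union>p'\<in>loop_class X x p. \<Union>q'\<in>loop_class X x q. loop_homotopy X x `` {q' +++ p'})"
    by (simp add: fundamental_group_def)
  also have "\<dots> = (\<Union>p'\<in>loop_class X x p. \<Union>q'\<in>loop_class X x q. loop_class X x (q +++ p))"
    using * by simp
  also have "\<dots> = loop_class X x (q +++ p)"
    using loop_class_self[OF assms(1)] loop_class_self[OF assms(2)] by auto
  finally show ?thesis .
qed

lemma group_fundamental_group:
  fixes x :: "'a::real_normed_vector"
  assumes "x \<in> X"
  shows "group (fundamental_group X x)"
proof (rule groupI)
  let ?G = "fundamental_group X x"
  show "\<one>\<^bsub>?G\<^esub> \<in> carrier ?G"
    using based_loops_const[OF assms] by (auto simp: one_fundamental_group carrier_fundamental_group)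
  fix c assume "c \<in> carrier ?G"
  then obtain p where p: "p \<in> based_loops X x" "c = loop_class X x p"
    by (auto simp: carrier_fundamental_group)
  \<comment> \<open>The product runs through its right factor first: the left unit law is the
    homotopy between p and p followed by the constant loop, and the left inverse law contracts p
    followed by its reverse.\<close>
  note const = based_loops_const[OF assms]
  show "\<one>\<^bsub>?G\<^esub> \<otimes>\<^bsub>?G\<^esub> c = c"
    unfolding p one_fundamental_group mult_fundamental_group[OF const p(1)]
    using p by (intro loop_class_eqI based_loops_join const)
       (auto simp: based_loops_def intro!: homotopic_paths_rid')
  show "\<exists>d\<in>carrier ?G. d \<otimes>\<^bsub>?G\<^esub> c = \<one>\<^bsub>?G\<^esub>"
  proof
    show "loop_class X x (reversepath p) \<in> carrier ?G"
      by (simp add: based_loops_reversepath carrier_fundamental_group p(1))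
    show "loop_class X x (reversepath p) \<otimes>\<^bsub>?G\<^esub> c = \<one>\<^bsub>?G\<^esub>"
      unfolding p one_fundamental_group mult_fundamental_group[OF based_loops_reversepath[OF p(1)] p(1)]
      using p homotopic_paths_rinv[of p X]
      by (intro loop_class_eqI based_loops_join const based_loops_reversepath)
        (auto simp: based_loops_def)
  qed
  fix d assume "d \<in> carrier ?G"
  then obtain q where q: "q \<in> based_loops X x" "d = loop_class X x q"
    by (auto simp: carrier_fundamental_group)
  show "c \<otimes>\<^bsub>?G\<^esub> d \<in> carrier ?G"
    by (simp add: p q mult_fundamental_group carrier_fundamental_group based_loops_join)
  fix e assume "e \<in> carrier ?G"
  then obtain r where r: "r \<in> based_loops X x" "e = loop_class X x r"
    by (auto simp: carrier_fundamental_group)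
  have "homotopic_paths X (r +++ q +++ p) ((r +++ q) +++ p)"
    using p q r by (intro homotopic_paths_assoc) (auto simp: based_loops_def)
  then show "c \<otimes>\<^bsub>?G\<^esub> d \<otimes>\<^bsub>?G\<^esub> e = c \<otimes>\<^bsub>?G\<^esub> (d \<otimes>\<^bsub>?G\<^esub> e)"
    using p q r loop_class_eqI[of "r +++ q +++ p" X x "(r +++ q) +++ p"]
    by (simp add: mult_fundamental_group based_loops_join)
qed

lemma BijGroup_UNIV_simps:
  "carrier (BijGroup UNIV) = {g. bij g}"
  "one (BijGroup UNIV) = id"
  "bij g \<Longrightarrow> bij h \<Longrightarrow> g \<otimes>\<^bsub>BijGroup UNIV\<^esub> h = g \<circ> h"
  by (auto simp: BijGroup_def Bij_def compose_def fun_eq_iff)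

section \<open>Deck transformations and monodromy\<close>

locale deck_covering =
  fixes S :: "'a::real_normed_vector set" and p :: "'a \<Rightarrow> 'b::real_normed_vector"
    and X :: "'b set" and \<Gamma> :: "('a \<Rightarrow> 'a) set" and z0 :: 'a
  assumes cov: "covering_space S p X"
    and z0: "z0 \<in> S"
    and cont: "\<And>g. g \<in> \<Gamma> \<Longrightarrow> continuous_on S g"
    and maps: "\<And>g z. g \<in> \<Gamma> \<Longrightarrow> z \<in> S \<Longrightarrow> g z \<in> S"
    and comp: "\<And>g h. g \<in> \<Gamma> \<Longrightarrow> h \<in> \<Gamma> \<Longrightarrow> g \<circ> h \<in> \<Gamma>"
    and inverse: "\<And>g. g \<in> \<Gamma> \<Longrightarrow> \<exists>h\<in>\<Gamma>. h \<circ> g = id \<and> g \<circ> h = id"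
    and fibre: "\<And>z w. z \<in> S \<Longrightarrow> w \<in> S \<Longrightarrow> p z = p w \<longleftrightarrow> (\<exists>g\<in>\<Gamma>. w = g z)"
    and free: "\<And>g z. g \<in> \<Gamma> \<Longrightarrow> z \<in> S \<Longrightarrow> g z = z \<Longrightarrow> g = id"
begin

definition is_lift :: "(real \<Rightarrow> 'b) \<Rightarrow> 'a \<Rightarrow> (real \<Rightarrow> 'a) \<Rightarrow> bool" where
  "is_lift \<eta> z l \<longleftrightarrow> path l \<and> path_image l \<subseteq> S \<and> pathstart l = z \<and> (\<forall>t\<in>{0..1}. p (l t) = \<eta> t)"

text \<open>The group element carries the endpoint back to \<open>z0\<close>, not \<open>z0\<close>
  to the endpoint: the second choice would reverse products under the convention of
  \<open>fundamental_group\<close>. For classes of loops at \<open>p z0\<close> the description is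
  proper, since the endpoint depends on the class only and the action is free and transitive on
  fibres.\<close>

definition deck :: "(real \<Rightarrow> 'b) set \<Rightarrow> 'a \<Rightarrow> 'a" where
  "deck c = (THE g. g \<in> \<Gamma> \<and> (\<exists>\<eta>\<in>c. \<exists>l. is_lift \<eta> z0 l \<and> g (pathfinish l) = z0))"

lemma p_deck: "g \<in> \<Gamma> \<Longrightarrow> z \<in> S \<Longrightarrow> p (g z) = p z"
  using fibre[of z "g z"] maps[of g z] by auto

lemma bij_deck: "g \<in> \<Gamma> \<Longrightarrow> bij g"
  using inverse o_bij by blast

lemma deck_unique:
  assumes "g \<in> \<Gamma>" "h \<in> \<Gamma>" "z \<in> S" "g z = h z"
  shows "g = h"
proof -
  obtain h' where h': "h' \<in> \<Gamma>" "h' \<circ> h = id" "h \<circ> h' = id"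
    using inverse[OF assms(2)] by blast
  have "h' \<circ> g = id"
    using free[OF comp[OF h'(1) assms(1)] assms(3)] assms(4) h'(2) by (metis comp_apply id_apply)
  then show ?thesis
    using h'(3) by (metis comp_assoc comp_id id_comp)
qed

lemma lift_exists:
  assumes "\<eta> \<in> based_loops X x" "z \<in> S" "p z = x"
  obtains l where "is_lift \<eta> z l"
proof -
  have "path \<eta>" "path_image \<eta> \<subseteq> X" "pathstart \<eta> = p z"
    using assms by (auto simp: based_loops_def)
  then obtain l where "path l" "path_image l \<subseteq> S" "pathstart l = z"
    "\<And>t. t \<in> {0..1} \<Longrightarrow> p (l t) = \<eta> t"
    using covering_space_lift_path_strong[OF cov assms(2)] by blast
  then show ?thesis
    by (intro that[of l]) (simp add: is_lift_def)
qed

lemma lift_finish: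
  assumes "is_lift \<eta> z l" "\<eta> \<in> based_loops X x"
  shows "pathfinish l \<in> S" "p (pathfinish l) = x" "pathstart l \<in> S"
  using assms unfolding is_lift_def based_loops_def
  by (auto simp: pathfinish_def pathstart_def path_image_def)

lemma lift_finish_homotopic:
  assumes "is_lift \<eta> z l" "is_lift \<eta>' z l'" "homotopic_paths X \<eta> \<eta>'"
  shows "pathfinish l = pathfinish l'"
  using assms homotopic_paths_imp_path[OF assms(3)] homotopic_paths_imp_subset[OF assms(3)]
  unfolding is_lift_def by (intro covering_space_monodromy[OF cov, of \<eta> \<eta>']) auto

lemma lift_deck:
  assumes "g \<in> \<Gamma>" "is_lift \<eta> z l"
  shows "is_lift \<eta> (g z) (g \<circ> l)"
proof -
  have "l t \<in> S" if "t \<in> {0..1}" for t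
    using assms(2) that by (auto simp: is_lift_def path_image_def)
  then show ?thesis
    using assms maps[OF assms(1)] p_deck[OF assms(1)] continuous_on_subset[OF cont[OF assms(1)]]
    by (auto simp: is_lift_def pathstart_def path_image_def intro!: path_continuous_image)
qed

lemma lift_join:
  assumes "is_lift q z l" "is_lift r (pathfinish l) k"
  shows "is_lift (q +++ r) z (l +++ k)"
proof -
  have "p ((l +++ k) t) = (q +++ r) t" if "t \<in> {0..1}" for t
    using assms that by (auto simp: is_lift_def joinpaths_def)
  then show ?thesis
    using assms path_image_join_subset[of l k] by (auto simp: is_lift_def)
qed

lemma deck_eqI:
  assumes "\<eta> \<in> based_loops X (p z0)" "is_lift \<eta> z0 l" "g \<in> \<Gamma>" "g (pathfinish l) = z0"
  shows "deck (loop_class X (p z0) \<eta>) = g"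
  unfolding deck_def
proof (rule the_equality)
  show "g \<in> \<Gamma> \<and> (\<exists>\<eta>\<in>loop_class X (p z0) \<eta>. \<exists>l. is_lift \<eta> z0 l \<and> g (pathfinish l) = z0)"
    using assms loop_class_self by blast
  fix h assume "h \<in> \<Gamma> \<and> (\<exists>\<eta>\<in>loop_class X (p z0) \<eta>. \<exists>l. is_lift \<eta> z0 l \<and> h (pathfinish l) = z0)"
  then obtain \<eta>' l' where *: "h \<in> \<Gamma>" "homotopic_paths X \<eta> \<eta>'" "is_lift \<eta>' z0 l'" "h (pathfinish l') = z0"
    by (auto simp: mem_loop_class)
  have "pathfinish l = pathfinish l'"
    using lift_finish_homotopic[OF assms(2) *(3,2)] .
  then show "h = g"
    using deck_unique[OF *(1) assms(3) lift_finish(1)[OF assms(2,1)]] *(4) assms(4) by simp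
qed

lemma deck_obtain:
  assumes "\<eta> \<in> based_loops X (p z0)"
  obtains l g where "is_lift \<eta> z0 l" "g \<in> \<Gamma>" "g (pathfinish l) = z0"
proof -
  obtain l where l: "is_lift \<eta> z0 l"
    using lift_exists[OF assms z0] by blast
  then obtain g where "g \<in> \<Gamma>" "z0 = g (pathfinish l)"
    using fibre[OF lift_finish(1)[OF l assms] z0] lift_finish(2)[OF l assms] by auto
  then show ?thesis using that l by auto
qed

lemma deck_in:
  assumes "c \<in> carrier (fundamental_group X (p z0))"
  shows "deck c \<in> \<Gamma>"
proof -
  obtain \<eta> where \<eta>: "\<eta> \<in> based_loops X (p z0)" "c = loop_class X (p z0) \<eta>"
    using assms by (auto simp: carrier_fundamental_group)
  then obtain l g where "is_lift \<eta> z0 l" "g \<in> \<Gamma>" "g (pathfinish l) = z0"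
    using deck_obtain by blast
  then show ?thesis
    using deck_eqI \<eta> by simp
qed

lemma deck_hom: "deck \<in> hom (fundamental_group X (p z0)) (BijGroup UNIV)"
proof (rule homI)
  let ?G = "fundamental_group X (p z0)"
  show "deck c \<in> carrier (BijGroup UNIV)" if "c \<in> carrier ?G" for c
    using deck_in[OF that] bij_deck by (simp add: BijGroup_UNIV_simps)
  fix c d assume "c \<in> carrier ?G" "d \<in> carrier ?G"
  then obtain r q where r: "r \<in> based_loops X (p z0)" "c = loop_class X (p z0) r"
    and q: "q \<in> based_loops X (p z0)" "d = loop_class X (p z0) q"
    by (auto simp: carrier_fundamental_group)
  obtain k g where k: "is_lift r z0 k" "g \<in> \<Gamma>" "g (pathfinish k) = z0"
    using deck_obtain[OF r(1)] by blast
  obtain l h where l: "is_lift q z0 l" "h \<in> \<Gamma>" "h (pathfinish l) = z0"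
    using deck_obtain[OF q(1)] by blast
  obtain h' where h': "h' \<in> \<Gamma>" "h' \<circ> h = id" "h \<circ> h' = id"
    using inverse[OF l(2)] by blast
  \<comment> \<open>The lift of \<open>q\<close> ends at the translate of \<open>z0\<close> by the
    inverse of \<open>h\<close>, so the lift of \<open>r\<close> has to be translated by that
    inverse before the two are joined.\<close>
  have "h' z0 = pathfinish l"
    using h'(2) l(3) by (metis comp_apply id_apply)
  then have "is_lift r (pathfinish l) (h' \<circ> k)"
    using lift_deck[OF h'(1) k(1)] by simp
  then have L: "is_lift (q +++ r) z0 (l +++ (h' \<circ> k))"
    using lift_join[OF l(1)] by blast
  have "(g \<circ> h) (pathfinish (l +++ (h' \<circ> k))) = g ((h \<circ> h') (pathfinish k))"
    by (simp add: pathfinish_compose)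
  then have "(g \<circ> h) (pathfinish (l +++ (h' \<circ> k))) = z0"
    using h' k by simp
  then have "deck (loop_class X (p z0) (q +++ r)) = g \<circ> h"
    using deck_eqI[OF based_loops_join[OF q(1) r(1)] L comp[OF k(2) l(2)]] by blast
  then show "deck (c \<otimes>\<^bsub>?G\<^esub> d) = deck c \<otimes>\<^bsub>BijGroup UNIV\<^esub> deck d"
    using r q k l by (simp add: mult_fundamental_group BijGroup_UNIV_simps bij_deck deck_eqI)
qed

text \<open>Reduces surjectivity of \<open>deck\<close> to finding paths in \<open>S\<close>: the
  projection of a path from \<open>z0\<close> to another point of its orbit is a loop.\<close>

lemma deck_surj:
  assumes g: "g \<in> \<Gamma>" and l: "path l" "path_image l \<subseteq> S" "pathstart l = z0" "g (pathfinish l) = z0"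
  shows "g \<in> deck ` carrier (fundamental_group X (p z0))"
proof -
  have pf: "pathfinish l \<in> S"
    using l by (metis pathfinish_in_path_image subsetD)
  have "p ` S = X"
    by (rule covering_space_imp_surjective[OF cov])
  moreover have "p (pathfinish l) = p z0"
    using p_deck[OF g pf] l by simp
  moreover have "path (p \<circ> l)"
    using l covering_space_imp_continuous[OF cov]
    by (auto intro!: path_continuous_image elim: continuous_on_subset)
  ultimately have b: "p \<circ> l \<in> based_loops X (p z0)"
    using l by (auto simp: based_loops_def path_image_compose pathstart_compose pathfinish_compose)
  have "is_lift (p \<circ> l) z0 l"
    using l by (auto simp: is_lift_def)
  then show ?thesis
    using deck_eqI[OF b _ g l(4)] b by (auto simp: carrier_fundamental_group image_iff)
qed

text \<open>A lift of a loop by F is turned into a lift by p by lifting it to S and applying M.\<close>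

lemma monodromy_semiconjugate:
  assumes F: "\<And>z. F (p z) = p (M z)" and X: "\<And>z. p z \<in> X \<longleftrightarrow> z \<in> S" and surj: "surj p"
    and SM: "\<And>z. M z \<in> S \<Longrightarrow> z \<in> S" and pcont: "continuous_on UNIV p"
    and M: "continuous_on UNIV M" "continuous_on UNIV N" "\<And>z. M (N z) = z" "\<And>z. N (M z) = z"
    and eta: "\<eta> \<in> based_loops X x" and w: "p (M w) = x" and l: "is_lift \<eta> (M w) l"
  shows "monodromy F X x (loop_class X x \<eta>) (p w) = p (N (pathfinish l))"
proof -
  \<comment> \<open>A lift of a loop by \<open>F\<close> lies over \<open>X\<close> as well, so it
    can be lifted further through \<open>p\<close>.\<close>
  have FX: "y \<in> X" if "F y \<in> X" for y
  proof -
    obtain z where z: "y = p z"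
      using surj by (meson surjD)
    then show ?thesis
      using that SM by (simp add: F X)
  qed
  have "monodromy F X x (loop_class X x \<eta>) (p w) = 
    (THE z. \<exists>\<eta>\<in>loop_class X x \<eta>. \<exists>l. path l \<and> path_image l \<subseteq> F -` X \<and>
       (\<forall>t\<in>{0..1}. F (l t) = \<eta> t) \<and> pathstart l = p w \<and> pathfinish l = z)"
    unfolding monodromy_def using F w by simp
  also have "\<dots> = p (N (pathfinish l))"
  proof (rule the_equality, goal_cases)
    case 1
    have l': "path l" "path_image l \<subseteq> S" "pathstart l = M w" "\<And>t. t \<in> {0..1} \<Longrightarrow> p (l t) = \<eta> t"
      using l by (auto simp: is_lift_def)
    show ?case
    \<comment> \<open>\<open>F (p (N z)) = p z\<close>, so undoing \<open>M\<close> on the lift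
      \<open>l\<close> yields a lift of the loop by \<open>F\<close>.\<close>
    proof (intro bexI[of _ \<eta>] exI[of _ "p \<circ> N \<circ> l"] conjI)
      have "continuous_on UNIV (p \<circ> N)"
        by (rule continuous_on_compose[OF M(2) continuous_on_subset[OF pcont subset_UNIV]])
      then show "path (p \<circ> N \<circ> l)"
        by (intro path_continuous_image l') (auto elim: continuous_on_subset)
      show "path_image (p \<circ> N \<circ> l) \<subseteq> F -` X"
        using l'(2) by (auto simp: path_image_def F M X)
      show "\<forall>t\<in>{0..1}. F ((p \<circ> N \<circ> l) t) = \<eta> t"
        using l'(4) by (simp add: F M)
      show "pathstart (p \<circ> N \<circ> l) = p w"
        using l'(3) by (simp add: pathstart_compose M)
      show "pathfinish (p \<circ> N \<circ> l) = p (N (pathfinish l))"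
        by (simp add: pathfinish_compose)
    qed (rule loop_class_self[OF eta])
  next
    case (2 z)
    then obtain \<eta>' k where k: "\<eta>' \<in> loop_class X x \<eta>" "path k" "path_image k \<subseteq> F -` X"
      "\<And>t. t \<in> {0..1} \<Longrightarrow> F (k t) = \<eta>' t" "pathstart k = p w" "pathfinish k = z"
      by blast
    have "path_image k \<subseteq> X"
      using k(3) FX by blast
    moreover have "w \<in> S"
      using lift_finish(3)[OF l eta] l SM by (simp add: is_lift_def)
    ultimately obtain h where h: "path h" "path_image h \<subseteq> S" "pathstart h = w"
      "\<And>t. t \<in> {0..1} \<Longrightarrow> p (h t) = k t"
      using covering_space_lift_path_strong[OF cov _ k(2) _ k(5)] by blast
    have hom: "homotopic_paths X \<eta>' \<eta>"
      using k(1) by (simp add: mem_loop_class homotopic_paths_sym)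
    have Mh: "p ((M \<circ> h) t) = \<eta>' t" if "t \<in> {0..1}" for t
      using h(4)[OF that] k(4)[OF that] F by (metis comp_apply)
    have "is_lift \<eta>' (M w) (M \<circ> h)"
      unfolding is_lift_def
    proof (intro conjI ballI Mh)
      show "path (M \<circ> h)"
        using h M by (intro path_continuous_image) (auto elim: continuous_on_subset)
      have "\<eta>' t \<in> X" if "t \<in> {0..1}" for t
        using k(1) that by (auto simp: mem_loop_class based_loops_def path_image_def)
      then have "(M \<circ> h) t \<in> S" if "t \<in> {0..1}" for t
        using Mh[OF that] X[of "(M \<circ> h) t"] that by simp
      then show "path_image (M \<circ> h) \<subseteq> S"
        unfolding path_image_def by blast
      show "pathstart (M \<circ> h) = M w"
        using h by (simp add: pathstart_compose)
    qed
    then have "pathfinish l = M (pathfinish h)"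
      using lift_finish_homotopic[OF _ l hom] by (metis pathfinish_compose comp_apply)
    then have "p (N (pathfinish l)) = p (pathfinish h)"
      by (simp add: M)
    then show ?case
      using h(4)[of 1] k(6) by (simp add: pathfinish_def)
  qed
  finally show ?thesis .
qed

end

section \<open>The deltoid as a discriminant\<close>

definition circle_exp :: "complex \<Rightarrow> complex"
  where "circle_exp t = exp (2 * pi * \<i> * t)"

lemma circle_exp_nonzero [simp]: "circle_exp t \<noteq> 0"
  by (simp add: circle_exp_def)

lemma circle_exp_0 [simp]: "circle_exp 0 = 1"
  by (simp add: circle_exp_def)

lemma circle_exp_add: "circle_exp (s + t) = circle_exp s * circle_exp t"
  by (simp add: circle_exp_def exp_add distrib_left)

lemma circle_exp_minus: "circle_exp (- t) = 1 / circle_exp t"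
  by (simp add: circle_exp_def exp_minus divide_inverse)

lemma circle_exp_diff: "circle_exp (s - t) = circle_exp s / circle_exp t"
  using circle_exp_add[of s "- t"] by (simp add: circle_exp_minus)

lemma circle_exp_eq_iff: "circle_exp s = circle_exp t \<longleftrightarrow> s - t \<in> \<int>"
proof -
  have "circle_exp s = circle_exp t \<longleftrightarrow> (\<exists>n::int. s = t + of_int n)"
  proof -
    have "2 * pi * \<i> * s = 2 * pi * \<i> * t + of_int (2 * n) * pi * \<i> \<longleftrightarrow> s = t + of_int n" for n :: int
    proof -
      have "2 * pi * \<i> * t + of_int (2 * n) * pi * \<i> = 2 * pi * \<i> * (t + of_int n)"
        by (simp add: algebra_simps)
      then show ?thesis by simp
    qed
    then show ?thesis
      unfolding circle_exp_def exp_eq by simp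
  qed
  then show ?thesis
    by (auto simp: Ints_def algebra_simps image_iff)
qed

lemma circle_exp_surj:
  assumes "u \<noteq> 0"
  obtains t where "circle_exp t = u"
proof
  show "circle_exp (Ln u / (2 * pi * \<i>)) = u"
    using assms by (simp add: circle_exp_def)
qed

lemma one_third_not_Ints: "1 / 3 \<notin> (\<int> :: complex set)" "2 / 3 \<notin> (\<int> :: complex set)"
proof -
  have "of_int k * 3 \<noteq> (1 :: complex)" "of_int k * 3 \<noteq> (2 :: complex)" for k
  proof -
    have "k * 3 \<noteq> 1" "k * 3 \<noteq> 2" by presburger+
    then have "complex_of_int (k * 3) \<noteq> of_int 1" "complex_of_int (k * 3) \<noteq> of_int 2"
      unfolding of_int_eq_iff by blast+
    then show "of_int k * 3 \<noteq> (1 :: complex)" "of_int k * 3 \<noteq> (2 :: complex)"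
      unfolding of_int_mult of_int_numeral of_int_1 by blast+
  qed
  then show "1 / 3 \<notin> (\<int> :: complex set)" "2 / 3 \<notin> (\<int> :: complex set)"
    by (auto simp: Ints_def field_simps)
qed

text \<open>The triple of exponentials has product 1, so the second coordinate, the sum of their
  reciprocals, is their second elementary symmetric function. On the diagonal torus of SL(3) the two
  coordinates are the trace of a matrix and of its inverse.\<close>

definition torus_param :: "complex \<times> complex \<Rightarrow> complex \<times> complex"
  where "torus_param = (\<lambda>(x, y).
    (circle_exp x + circle_exp y + circle_exp (- x - y),
     circle_exp (- x) + circle_exp (- y) + circle_exp (x + y)))"

text \<open>The three forms are, up to sign, the differences within the triple (x, y, - x - y), that
  is, the roots of A2. The excluded lines are their integral level sets.\<close>

definition regular_points :: "(complex \<times> complex) set"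
  where "regular_points = {(x, y). x - y \<notin> \<int> \<and> x + 2 * y \<notin> \<int> \<and> 2 * x + y \<notin> \<int>}"

text \<open>The permutations of the coordinates of the triple (x, y, - x - y).\<close>

definition weyl :: "(complex \<times> complex \<Rightarrow> complex \<times> complex) set"
  where "weyl = {\<lambda>(x, y). (x, y), \<lambda>(x, y). (y, x), \<lambda>(x, y). (x, - x - y),
    \<lambda>(x, y). (- x - y, y), \<lambda>(x, y). (y, - x - y), \<lambda>(x, y). (- x - y, x)}"

text \<open>An integral translation of (x, y) shifts (x, y, - x - y) by an integral triple of sum
  zero, so the translations form the coroot lattice of A2.\<close>

definition affine_weyl :: "(complex \<times> complex \<Rightarrow> complex \<times> complex) set"
  where "affine_weyl = {g. \<exists>\<sigma>\<in>weyl. \<exists>v\<in>\<int> \<times> \<int>. g = (\<lambda>z. \<sigma> z + v)}"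

lemma weyl_id: "id \<in> weyl"
proof -
  have "(\<lambda>(x, y). (x, y)) = (id :: complex \<times> complex \<Rightarrow> _)" by auto
  then show ?thesis by (simp add: weyl_def)
qed

lemma weyl_comp: "\<sigma> \<in> weyl \<Longrightarrow> \<tau> \<in> weyl \<Longrightarrow> \<sigma> \<circ> \<tau> \<in> weyl"
  unfolding weyl_def by (elim insertE emptyE) (simp_all add: fun_eq_iff)

lemma weyl_inverse:
  assumes "\<sigma> \<in> weyl"
  shows "\<exists>\<tau>\<in>weyl. \<tau> \<circ> \<sigma> = id \<and> \<sigma> \<circ> \<tau> = id"
proof -
  \<comment> \<open>A permutation of three letters has order 1, 2 or 3, so its inverse is itself or
    its square.\<close>
  have "\<sigma> \<circ> \<sigma> = id \<or> \<sigma> \<circ> \<sigma> \<circ> \<sigma> = id"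
    using assms unfolding weyl_def by (elim insertE emptyE) (simp_all add: fun_eq_iff)
  then show ?thesis
    using weyl_comp[OF assms assms] assms by (metis comp_assoc)
qed

lemma weyl_add: "\<sigma> \<in> weyl \<Longrightarrow> \<sigma> (v + w) = \<sigma> v + \<sigma> w"
  unfolding weyl_def by (cases v; cases w) auto

lemma weyl_scaleR: "\<sigma> \<in> weyl \<Longrightarrow> \<sigma> (c *\<^sub>R v) = c *\<^sub>R \<sigma> v"
  unfolding weyl_def by (cases v) (auto simp: algebra_simps)

lemma weyl_Ints: "\<sigma> \<in> weyl \<Longrightarrow> v \<in> \<int> \<times> \<int> \<Longrightarrow> \<sigma> v \<in> \<int> \<times> \<int>"
  unfolding weyl_def by auto

lemma weyl_0: "\<sigma> \<in> weyl \<Longrightarrow> \<sigma> 0 = 0"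
  unfolding weyl_def by (auto simp: zero_prod_def)

lemma weyl_continuous: "\<sigma> \<in> weyl \<Longrightarrow> continuous_on A \<sigma>"
  unfolding weyl_def by (auto simp: case_prod_unfold intro!: continuous_intros)

lemma affine_weylI: "\<sigma> \<in> weyl \<Longrightarrow> v \<in> \<int> \<times> \<int> \<Longrightarrow> (\<lambda>z. \<sigma> z + v) \<in> affine_weyl"
  unfolding affine_weyl_def by blast

lemma affine_weylE:
  assumes "g \<in> affine_weyl"
  obtains \<sigma> v where "\<sigma> \<in> weyl" "v \<in> \<int> \<times> \<int>" "g = (\<lambda>z. \<sigma> z + v)"
  using assms unfolding affine_weyl_def by blast

lemma Ints_pair_add: "v \<in> \<int> \<times> \<int> \<Longrightarrow> w \<in> \<int> \<times> \<int> \<Longrightarrow> v + w \<in> \<int> \<times> (\<int> :: complex set)"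
  by (cases v; cases w) auto

lemma Ints_pair_uminus: "v \<in> \<int> \<times> \<int> \<Longrightarrow> - v \<in> \<int> \<times> (\<int> :: complex set)"
  by (cases v) auto

lemma affine_weyl_comp:
  assumes "g \<in> affine_weyl" "h \<in> affine_weyl"
  shows "g \<circ> h \<in> affine_weyl"
proof -
  obtain \<sigma> v \<tau> w where g: "\<sigma> \<in> weyl" "v \<in> \<int> \<times> \<int>" "g = (\<lambda>z. \<sigma> z + v)"
    and h: "\<tau> \<in> weyl" "w \<in> \<int> \<times> \<int>" "h = (\<lambda>z. \<tau> z + w)"
    using assms by (metis affine_weylE)
  have "g \<circ> h = (\<lambda>z. (\<sigma> \<circ> \<tau>) z + (\<sigma> w + v))"
    by (auto simp: g h weyl_add add.assoc)
  then show ?thesis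
    using g h by (simp only: affine_weylI weyl_comp weyl_Ints Ints_pair_add)
qed

lemma affine_weyl_inverse:
  assumes "g \<in> affine_weyl"
  shows "\<exists>h\<in>affine_weyl. h \<circ> g = id \<and> g \<circ> h = id"
proof -
  obtain \<sigma> v where g: "\<sigma> \<in> weyl" "v \<in> \<int> \<times> \<int>" "g = (\<lambda>z. \<sigma> z + v)"
    using assms by (rule affine_weylE)
  obtain \<tau> where \<tau>: "\<tau> \<in> weyl" "\<tau> \<circ> \<sigma> = id" "\<sigma> \<circ> \<tau> = id"
    using weyl_inverse[OF g(1)] by blast
  have 1: "\<tau> (\<sigma> z) = z" "\<sigma> (\<tau> z) = z" for z
    using \<tau> by (metis comp_apply id_apply)+
  show ?thesis
  proof (intro bexI[of _ "\<lambda>z. \<tau> z + \<tau> (- v)"] conjI)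
    show "(\<lambda>z. \<tau> z + \<tau> (- v)) \<in> affine_weyl"
      by (rule affine_weylI[OF \<tau>(1) weyl_Ints[OF \<tau>(1) Ints_pair_uminus[OF g(2)]]])
    show "(\<lambda>z. \<tau> z + \<tau> (- v)) \<circ> g = id"
      by (rule ext) (simp add: g weyl_add[OF \<tau>(1), symmetric] 1)
    show "g \<circ> (\<lambda>z. \<tau> z + \<tau> (- v)) = id"
      by (rule ext) (simp add: g weyl_add[OF \<tau>(1), symmetric] 1)
  qed
qed

lemma affine_weyl_continuous: "g \<in> affine_weyl \<Longrightarrow> continuous_on A g"
  by (erule affine_weylE) (simp add: continuous_on_add weyl_continuous)

section \<open>Symmetric functions and the fibres of the parametrization\<close>

lemma circle_exp_third: "circle_exp (- x - y) = 1 / (circle_exp x * circle_exp y)"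
  by (simp add: circle_exp_diff circle_exp_minus)

lemma torus_param_symmetric:
  assumes "u = circle_exp x" "v = circle_exp y" "w = circle_exp (- x - y)"
  shows "torus_param (x, y) = (u + v + w, u * v + v * w + w * u)" "u * v * w = 1"
  using assms by (simp_all add: torus_param_def circle_exp_third circle_exp_minus circle_exp_add field_simps)

text \<open>The symmetric functions are the coefficients of a monic cubic, so u' is one of its
  roots, and removing that root leaves a quadratic for the other two. Repeated roots are allowed, as
  the description of the deltoid requires.\<close>

lemma roots_unique:
  fixes u v w :: "'a::idom"
  assumes "u + v + w = u' + v' + w'" "u * v + v * w + w * u = u' * v' + v' * w' + w' * u'"
    "u * v * w = u' * v' * w'"
  shows "(u', v', w') \<in> {(u, v, w), (v, u, w), (u, w, v), (w, v, u), (v, w, u), (w, u, v)}"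
proof -
  have quad: "v' = v \<and> w' = w \<or> v' = w \<and> w' = v"
    if "v + w = v' + w'" "v * w = v' * w'" for v w v' w' :: 'a
  proof -
    have "(v' - v) * (v' - w) = v' * v' - v' * (v + w) + v * w"
      by (simp add: algebra_simps)
    also have "\<dots> = 0"
      unfolding that by (simp add: algebra_simps)
    finally have "v' = v \<or> v' = w" by simp
    then show ?thesis
      using that(1) by (auto simp: algebra_simps)
  qed
  have step: "v' = v \<and> w' = w \<or> v' = w \<and> w' = v"
    if "u + v + w = u + v' + w'" "u * v + v * w + w * u = u * v' + v' * w' + w' * u"
    for u v w v' w' :: 'a
  proof (rule quad)
    show s: "v + w = v' + w'" using that(1) by (simp add: algebra_simps)
    have "v * w + u * (v + w) = v' * w' + u * (v' + w')"
      using that(2) by (simp add: algebra_simps)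
    then show "v * w = v' * w'" by (simp add: s)
  qed
  have "(u' - u) * (u' - v) * (u' - w) = 
    u' * u' * u' - u' * u' * (u + v + w) + u' * (u * v + v * w + w * u) - u * v * w"
    by (simp add: algebra_simps)
  also have "\<dots> = 0"
    unfolding assms by (simp add: algebra_simps)
  finally consider "u' = u" | "u' = v" | "u' = w" by auto
  then show ?thesis
  proof cases
    case 1
    then show ?thesis using step[of u v w v' w'] assms by auto
  next
    case 2
    then show ?thesis using step[of v u w v' w'] assms by (auto simp: algebra_simps)
  next
    case 3
    then show ?thesis using step[of w u v v' w'] assms by (auto simp: algebra_simps)
  qed
qed

text \<open>Equal values give equal cubics, so the two triples of exponentials agree up to a
  permutation; once \<open>\<sigma>\<close> has accounted for it, the exponents differ by integers,
  which form the translation part.\<close>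

lemma torus_param_eq_iff:
  "torus_param z = torus_param w \<longleftrightarrow> (\<exists>g\<in>affine_weyl. w = g z)"
proof
  obtain x y x' y' where z: "z = (x, y)" "w = (x', y')" by (cases z; cases w)
  have sub: "\<exists>g\<in>affine_weyl. w = g z"
    if s: "\<sigma> \<in> weyl" "\<sigma> (x, y) = (s, t)" and "circle_exp x' = circle_exp s" "circle_exp y' = circle_exp t"
    for \<sigma> s t
  proof (rule bexI[of _ "\<lambda>z. \<sigma> z + (x' - s, y' - t)"])
    show "w = \<sigma> z + (x' - s, y' - t)"
      by (simp add: z s)
    show "(\<lambda>z. \<sigma> z + (x' - s, y' - t)) \<in> affine_weyl"
      using that by (intro affine_weylI s) (simp add: circle_exp_eq_iff)
  qed
  assume *: "torus_param z = torus_param w"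
  have "(circle_exp x', circle_exp y', circle_exp (- x' - y')) \<in>
    (let u = circle_exp x; v = circle_exp y; w = circle_exp (- x - y) in
      {(u, v, w), (v, u, w), (u, w, v), (w, v, u), (v, w, u), (w, u, v)})"
    unfolding Let_def
    by (rule roots_unique)
      (use * torus_param_symmetric[OF refl refl refl, of x y]
        torus_param_symmetric[OF refl refl refl, of x' y'] in \<open>simp_all add: z\<close>)
  then show "\<exists>g\<in>affine_weyl. w = g z"
    using sub[of "\<lambda>(x, y). (x, y)" x y] sub[of "\<lambda>(x, y). (y, x)" y x]
     sub[of "\<lambda>(x, y). (x, - x - y)" x "- x - y"] sub[of "\<lambda>(x, y). (- x - y, y)" "- x - y" y]
     sub[of "\<lambda>(x, y). (y, - x - y)" y "- x - y"] sub[of "\<lambda>(x, y). (- x - y, x)" "- x - y" x]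
    unfolding Let_def by (auto simp: weyl_def)
next
  assume "\<exists>g\<in>affine_weyl. w = g z"
  then obtain \<sigma> v where *: "\<sigma> \<in> weyl" "v \<in> \<int> \<times> \<int>" "w = \<sigma> z + v"
    by (metis affine_weylE)
  have "torus_param (\<sigma> z + v) = torus_param (\<sigma> z)"
  proof -
    obtain x y m n where xy: "\<sigma> z = (x, y)" "v = (m, n)" by (cases "\<sigma> z"; cases v)
    have "m \<in> \<int>" "n \<in> \<int>"
      using *(2) xy by auto
    then have "circle_exp (x + m) = circle_exp x" "circle_exp (y + n) = circle_exp y"
      by (auto simp: circle_exp_eq_iff)
    moreover from this have "circle_exp (- (x + m) - (y + n)) = circle_exp (- x - y)"
      unfolding circle_exp_third by simp
    ultimately have "torus_param (x + m, y + n) = torus_param (x, y)"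
      unfolding torus_param_symmetric(1)[OF refl refl refl] by (simp only:)
    then show ?thesis
      by (simp add: xy)
  qed
  moreover have "torus_param (\<sigma> z) = torus_param z"
    using *(1) by (cases z) (auto simp: weyl_def torus_param_def algebra_simps intro: arg_cong[OF minus_diff_commute])
  ultimately show "torus_param z = torus_param w"
    using * by simp
qed

lemma torus_param_surj: "surj torus_param"
proof -
  have "\<exists>z. torus_param z = (X, Y)" for X Y
  proof -
    \<comment> \<open>The cubic t^3 - X t^2 + Y t - 1 whose roots are to be the three exponentials;
      its constant term keeps the roots away from 0.\<close>
    have "\<not> constant (poly [:- 1, Y, - X, 1:])"
      by (simp add: constant_degree)
    then obtain u where "poly [:- 1, Y, - X, 1:] u = 0"
      using fundamental_theorem_of_algebra by blast
    then have u: "u * u * u - X * u * u + Y * u - 1 = 0"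
      by (simp add: algebra_simps)
    then have u0: "u \<noteq> 0" by auto
    \<comment> \<open>The quadratic left after dividing out u: the other two roots have sum X - u
      and product 1 / u.\<close>
    have "\<not> constant (poly [:1 / u, - (X - u), 1:])"
      by (simp add: constant_degree)
    then obtain v where "poly [:1 / u, - (X - u), 1:] v = 0"
      using fundamental_theorem_of_algebra by blast
    then have v: "1 / u - (X - u) * v + v * v = 0"
      by (simp add: algebra_simps)
    have uv: "u * v * (X - u - v) = 1"
    proof -
      have "v * (X - u - v) = 1 / u"
        using v by (simp add: algebra_simps)
      then show ?thesis using u0 by (simp add: mult.assoc)
    qed
    then have v0: "v \<noteq> 0" by auto
    obtain x where x: "circle_exp x = u" using circle_exp_surj[OF u0] .
    obtain y where y: "circle_exp y = v" using circle_exp_surj[OF v0] .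
    have w: "circle_exp (- x - y) = X - u - v"
      using uv u0 v0 by (simp add: circle_exp_third x y field_simps)
    \<comment> \<open>Multiplied by u, the second symmetric function becomes 1 + X u^2 - u^3, which
      is Y u by the cubic.\<close>
    have "u * (u * v + v * (X - u - v) + (X - u - v) * u) = u * u * v + u * v * (X - u - v) + X * u * u - u * u * u - u * u * v"
      by (simp add: algebra_simps)
    also have "\<dots> = Y * u"
      using u uv by (simp add: algebra_simps)
    finally have "u * v + v * (X - u - v) + (X - u - v) * u = Y"
      using u0 by (simp add: mult.commute)
    then have "torus_param (x, y) = (X, Y)"
      using torus_param_symmetric(1)[OF refl refl refl, of x y] by (simp add: x y w)
    then show ?thesis ..
  qed
  then show ?thesis unfolding surj_def by (metis surj_pair)
qed

lemma not_regular_iff: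
  "(x, y) \<notin> regular_points \<longleftrightarrow> circle_exp x = circle_exp y \<or> circle_exp y = circle_exp (- x - y)
     \<or> circle_exp x = circle_exp (- x - y)"
  by (auto simp: regular_points_def circle_exp_eq_iff algebra_simps mult_2)

text \<open>The point of the deltoid with parameter t consists of the first two symmetric functions
  of the triple (t, t, 1 / t^2), the general triple of product 1 with a repeated entry.\<close>

lemma torus_param_deltoid: "torus_param z \<notin> deltoid \<longleftrightarrow> z \<in> regular_points"
proof -
  obtain x y where z: "z = (x, y)" by (cases z)
  define u v w where uvw: "u = circle_exp x" "v = circle_exp y" "w = circle_exp (- x - y)"
  note sym = torus_param_symmetric[OF uvw, folded z]
  have nz: "u \<noteq> 0" "v \<noteq> 0" "w \<noteq> 0" by (simp_all add: uvw)
  have 1: "(t + t + s, t * t + t * s + s * t) \<in> deltoid" if "t * t * s = 1" for t s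
  proof -
    have "t \<noteq> 0" using that by auto
    moreover from this have "s = 1 / t\<^sup>2"
      using that by (simp add: eq_divide_eq power2_eq_square ac_simps)
    ultimately show ?thesis
      unfolding deltoid_def by (intro image_eqI[of _ _ t]) (auto simp: field_simps power2_eq_square)
  qed
  have "torus_param z \<in> deltoid \<longleftrightarrow> u = v \<or> v = w \<or> u = w"
  proof
    assume "torus_param z \<in> deltoid"
    then obtain t where t: "t \<noteq> 0" "torus_param z = (2 * t + 1 / t\<^sup>2, 2 / t + t\<^sup>2)"
      unfolding deltoid_def by auto
    have "(t, t, 1 / t\<^sup>2) \<in> {(u, v, w), (v, u, w), (u, w, v), (w, v, u), (v, w, u), (w, u, v)}"
      using t sym by (intro roots_unique) (auto simp: field_simps power2_eq_square)
    then show "u = v \<or> v = w \<or> u = w" by auto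
  next
    assume "u = v \<or> v = w \<or> u = w"
    then show "torus_param z \<in> deltoid"
      using 1[of u w] 1[of v u] 1[of u v] sym by (auto simp: algebra_simps)
  qed
  then show ?thesis
    using not_regular_iff[of x y] z uvw by auto
qed

text \<open>Newton's identity p2 = e1^2 - 2 e2, applied to u, v, w and to the products vw, uw, uv.
  Since uvw = 1, these products are the reciprocals of u, v, w, and their second symmetric function
  is u + v + w.\<close>

lemma deltoid_map_torus_param: "deltoid_map (torus_param z) = torus_param ((- 2) *\<^sub>R z)"
proof -
  obtain x y where z: "z = (x, y)" by (cases z)
  have s: "(- 2) *\<^sub>R z = (- (2 * x), - (2 * y))"
    by (simp add: z scaleR_conv_of_real)
  define u v w where uvw: "u = circle_exp x" "v = circle_exp y" "w = circle_exp (- x - y)"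
  note sym = torus_param_symmetric[OF uvw]
  have "circle_exp (- (2 * x)) = (v * w)\<^sup>2" "circle_exp (- (2 * y)) = (u * w)\<^sup>2"
    "circle_exp (- (- (2 * x)) - (- (2 * y))) = (u * v)\<^sup>2"
    "circle_exp (- (- (2 * x))) = u\<^sup>2" "circle_exp (- (- (2 * y))) = v\<^sup>2"
    "circle_exp (- (2 * x) + - (2 * y)) = w\<^sup>2"
  proof -
    have "- (2 * x) = y + (- x - y) + (y + (- x - y))" "- (2 * y) = x + (- x - y) + (x + (- x - y))"
      "- (- (2 * x)) - (- (2 * y)) = x + y + (x + y)" "- (- (2 * x)) = x + x" "- (- (2 * y)) = y + y"
      "- (2 * x) + - (2 * y) = - x - y + (- x - y)"
      by simp_all
    then show "circle_exp (- (2 * x)) = (v * w)\<^sup>2" "circle_exp (- (2 * y)) = (u * w)\<^sup>2"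
      "circle_exp (- (- (2 * x)) - (- (2 * y))) = (u * v)\<^sup>2"
      "circle_exp (- (- (2 * x))) = u\<^sup>2" "circle_exp (- (- (2 * y))) = v\<^sup>2"
      "circle_exp (- (2 * x) + - (2 * y)) = w\<^sup>2"
      unfolding uvw power2_eq_square by (simp_all only: circle_exp_add)
  qed
  then have R: "torus_param ((- 2) *\<^sub>R z) = ((v * w)\<^sup>2 + (u * w)\<^sup>2 + (u * v)\<^sup>2, u\<^sup>2 + v\<^sup>2 + w\<^sup>2)"
    unfolding s torus_param_def prod.case by (simp only:)
  have "(u * v + v * w + w * u)\<^sup>2 - 2 * (u + v + w) =
    (v * w)\<^sup>2 + (u * w)\<^sup>2 + (u * v)\<^sup>2 + 2 * (u * v * w - 1) * (u + v + w)"
    by (simp add: power2_eq_square algebra_simps)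
  moreover have "(u + v + w)\<^sup>2 - 2 * (u * v + v * w + w * u) = u\<^sup>2 + v\<^sup>2 + w\<^sup>2"
    by (simp add: power2_eq_square algebra_simps)
  ultimately show ?thesis
    unfolding R unfolding z sym deltoid_map_def prod.case by simp
qed

lemma deltoid_map_funpow: "(deltoid_map ^^ n) (torus_param z) = torus_param ((- 2) ^ n *\<^sub>R z)"
  by (induction n arbitrary: z) (simp_all add: deltoid_map_torus_param funpow_swap1 mult.commute)

lemma torus_param_continuous: "continuous_on A torus_param"
  unfolding torus_param_def circle_exp_def case_prod_unfold by (intro continuous_intros)

lemma open_regular_points: "open regular_points"
proof -
  have *: "closed (f -` (\<int> :: complex set))" if "continuous_on UNIV f" for f :: "complex \<times> complex \<Rightarrow> complex"
    using that closed_Ints by (simp add: closed_vimage)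
  have "regular_points = - ((\<lambda>z. fst z - snd z) -` \<int> \<union> (\<lambda>z. fst z + 2 * snd z) -` \<int> \<union> (\<lambda>z. 2 * fst z + snd z) -` \<int>)"
    by (auto simp: regular_points_def)
  moreover have "open \<dots>"
    by (intro open_Compl closed_Un *; intro continuous_intros)
  ultimately show ?thesis by simp
qed

section \<open>Proper discontinuity of the affine Weyl group on the regular points\<close>

lemma Ints_separated:
  assumes "c \<notin> (\<int> :: complex set)"
  obtains \<delta> where "\<delta> > 0" "\<And>k. k \<in> \<int> \<Longrightarrow> \<delta> \<le> norm (k - c)"
proof -
  have "\<int> \<noteq> ({} :: complex set)" using Ints_0 by blast
  then have "infdist c \<int> > 0"
    using closed_Ints assms by (simp add: infdist_pos_not_in_closed)
  moreover have "infdist c \<int> \<le> norm (k - c)" if "k \<in> \<int>" for k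
    using infdist_le[OF that, of c] by (simp add: dist_norm norm_minus_commute)
  ultimately show ?thesis using that by blast
qed

text \<open>This yields freeness as well as the covering property, because an element that fixes
  \<open>z\<close> returns \<open>z\<close> to \<open>U\<close>.\<close>

lemma affine_weyl_wandering:
  assumes "z \<in> regular_points"
  shows "\<exists>U. open U \<and> z \<in> U \<and> U \<subseteq> regular_points \<and> (\<forall>g\<in>affine_weyl. \<forall>w\<in>U. g w \<in> U \<longrightarrow> g = id)"
proof -
  obtain x y where z: "z = (x, y)" by (cases z)
  with assms have reg: "x - y \<notin> \<int>" "x + 2 * y \<notin> \<int>" "2 * x + y \<notin> \<int>"
    by (auto simp: regular_points_def)
  obtain d1 where d1: "d1 > 0" "\<And>k. k \<in> \<int> \<Longrightarrow> d1 \<le> norm (k - (x - y))" using Ints_separated[OF reg(1)] by blast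
  obtain d2 where d2: "d2 > 0" "\<And>k. k \<in> \<int> \<Longrightarrow> d2 \<le> norm (k - (x + 2 * y))" using Ints_separated[OF reg(2)] by blast
  obtain d3 where d3: "d3 > 0" "\<And>k. k \<in> \<int> \<Longrightarrow> d3 \<le> norm (k - (2 * x + y))" using Ints_separated[OF reg(3)] by blast
  \<comment> \<open>At most three errors below \<open>\<epsilon>\<close> add up in
    \<open>no1\<close>, \<open>no2\<close> and \<open>no3\<close>, hence the factor 3; the bound 1
    serves the pure translations.\<close>
  define \<epsilon> where "\<epsilon> = min (min d1 d2) (min d3 1) / 3"
  have e: "\<epsilon> > 0" "3 * \<epsilon> \<le> d1" "3 * \<epsilon> \<le> d2" "3 * \<epsilon> \<le> d3" "3 * \<epsilon> \<le> 1"
    using d1 d2 d3 by (auto simp: \<epsilon>_def)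
  define U where "U = regular_points \<inter> (ball x \<epsilon> \<times> ball y \<epsilon>)"
  have U: "norm (a - x) < \<epsilon>" "norm (b - y) < \<epsilon>" if "(a, b) \<in> U" for a b
    using that by (auto simp: U_def dist_norm norm_minus_commute)
  have small: "k = 0" if "k \<in> \<int>" "norm k < 1" for k :: complex
    using that by (auto elim!: Ints_cases)
  have "g = id" if g: "g \<in> affine_weyl" and w: "w \<in> U" "g w \<in> U" for g w
  proof -
    obtain \<sigma> v where \<sigma>: "\<sigma> \<in> weyl" "v \<in> \<int> \<times> \<int>" "g = (\<lambda>z. \<sigma> z + v)"
      using g by (rule affine_weylE)
    obtain m n where v: "v = (m, n)" "m \<in> \<int>" "n \<in> \<int>" using \<sigma>(2) by auto
    obtain a b where ab: "w = (a, b)" by (cases w)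
    note A = U[OF w(1)[unfolded ab]]
    have no1: False if "k \<in> \<int>" "k - (x - y) = p + q" "norm p < \<epsilon>" "norm q < \<epsilon>" for k p q
      using d1(2)[OF that(1)] that(2-4) e norm_triangle_ineq[of p q] by simp
    have no2: False if "k \<in> \<int>" "k - (x + 2 * y) = p + q + r" "norm p < \<epsilon>" "norm q < \<epsilon>" "norm r < \<epsilon>" for k p q r
      using d2(2)[OF that(1)] that(2-5) e norm_triangle_ineq[of p q] norm_triangle_ineq[of "p + q" r] by simp
    have no3: False if "k \<in> \<int>" "k - (2 * x + y) = p + q + r" "norm p < \<epsilon>" "norm q < \<epsilon>" "norm r < \<epsilon>" for k p q r
      using d3(2)[OF that(1)] that(2-5) e norm_triangle_ineq[of p q] norm_triangle_ineq[of "p + q" r] by simp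
    have B: "norm (fst (\<sigma> (a, b)) + m - x) < \<epsilon>" "norm (snd (\<sigma> (a, b)) + n - y) < \<epsilon>"
      using U[of "fst (\<sigma> (a, b)) + m" "snd (\<sigma> (a, b)) + n"] w(2) by (auto simp: \<sigma> v ab plus_prod_def)
    from \<sigma>(1) consider "\<sigma> = (\<lambda>(x, y). (x, y))" | "\<sigma> = (\<lambda>(x, y). (y, x))" | "\<sigma> = (\<lambda>(x, y). (x, - x - y))"
      | "\<sigma> = (\<lambda>(x, y). (- x - y, y))" | "\<sigma> = (\<lambda>(x, y). (y, - x - y))" | "\<sigma> = (\<lambda>(x, y). (- x - y, x))"
      unfolding weyl_def by blast
    then show "g = id"
    \<comment> \<open>With \<open>(a, b)\<close> and its image both near \<open>(x, y)\<close>, a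
      nontrivial permutation makes one of \<open>m\<close>, \<open>n\<close>, \<open>- n\<close>
      nearly equal to a root evaluated at \<open>(x, y)\<close>, against the distance of that value
      from the integers. For the two 3-cycles one coordinate of the image suffices.\<close>
    proof cases
      case 1
      have "norm m < 1" "norm n < 1"
        using A B e norm_triangle_ineq4[of "a + m - x" "a - x"] norm_triangle_ineq4[of "b + n - y" "b - y"]
        by (auto simp: 1)
      then have "v = 0"
        using small v by (simp add: zero_prod_def)
      then show ?thesis by (auto simp: \<sigma> 1)
    next
      case 2
      show ?thesis
        using no1[of m "b + m - x" "- (b - y)"] v A B by (simp add: 2 norm_minus_commute)
    next
      case 3
      show ?thesis
        using no2[of n "- a - b + n - y" "a - x" "b - y"] v A B by (simp add: 3)
    next
      case 4
      show ?thesis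
        using no3[of m "- a - b + m - x" "a - x" "b - y"] v A B by (simp add: 4)
    next
      case 5
      show ?thesis
        using no1[of m "b + m - x" "- (b - y)"] v A B by (simp add: 5 norm_minus_commute)
    next
      case 6
      show ?thesis
        using no1[of "- n" "- (a + n - y)" "a - x"] v A B by (simp add: 6 norm_minus_commute)
    qed
  qed
  moreover have "open U"
    unfolding U_def by (intro open_Int open_regular_points open_Times open_ball)
  moreover have "z \<in> U"
    using assms e by (simp add: U_def z)
  moreover have "U \<subseteq> regular_points"
    by (simp add: U_def)
  ultimately show ?thesis by blast
qed

lemma affine_weyl_regular:
  assumes "g \<in> affine_weyl" "z \<in> regular_points"
  shows "g z \<in> regular_points"
proof -
  have "torus_param (g z) = torus_param z"
    using assms(1) torus_param_eq_iff by metis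
  then show ?thesis
    using assms(2) torus_param_deltoid by metis
qed

text \<open>Over (0, 0) the cubic is t^3 - 1, whose roots are the exponentials of (1/3, 0, -1/3).
  This lift satisfies x - y = x + 2 y = 1 - 2 x - y = 1/3, so it is the barycentre of the real
  triangle bounded by the fixed lines of \<open>simple_reflections\<close>.\<close>

lemma torus_param_base: "torus_param (1 / 3, 0) = (0, 0)"
proof -
  define u where "u = circle_exp (1 / 3)"
  have "u * u * u = circle_exp (1 / 3 + 1 / 3 + 1 / 3)"
    unfolding u_def circle_exp_add by simp
  also have "\<dots> = circle_exp 0"
    unfolding circle_exp_eq_iff by simp
  finally have "(u - 1) * (u * u + u + 1) = 0"
    by (simp add: algebra_simps)
  moreover have "u \<noteq> circle_exp 0"
    unfolding u_def circle_exp_eq_iff using one_third_not_Ints by simp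
  ultimately have "u * u + u + 1 = 0" by simp
  then have "1 + u + 1 / u = 0"
    by (simp add: field_simps u_def)
  then show ?thesis
    by (simp add: torus_param_def circle_exp_minus u_def[symmetric] ac_simps)
qed

lemma base_regular: "(1 / 3, 0) \<in> regular_points"
  using one_third_not_Ints by (simp add: regular_points_def)

section \<open>The kernel of the iterated monodromy\<close>

lemma regular_points_image: "torus_param ` regular_points = - deltoid"
proof (intro equalityI subsetI)
  fix y assume y: "y \<in> - deltoid"
  obtain z where "y = torus_param z"
    using torus_param_surj by (meson surjD)
  then show "y \<in> torus_param ` regular_points"
    using y torus_param_deltoid by auto
qed (metis ComplI imageE torus_param_deltoid)

interpretation deltoid_cover: deck_covering regular_points torus_param "- deltoid" affine_weyl "(1 / 3, 0)"
proof
  show "covering_space regular_points torus_param (- deltoid)"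
    unfolding regular_points_image[symmetric]
  proof (rule covering_space_of_action[where \<Gamma> = affine_weyl])
    show "torus_param z = torus_param w \<longleftrightarrow> (\<exists>g\<in>affine_weyl. w = g z)" for z w
      by (rule torus_param_eq_iff)
    show "DIM(complex \<times> complex) \<le> DIM(complex \<times> complex)" ..
  qed (fact open_regular_points torus_param_continuous affine_weyl_continuous affine_weyl_regular
        affine_weyl_comp affine_weyl_inverse affine_weyl_wandering)+
  show "g = id" if "g \<in> affine_weyl" "z \<in> regular_points" "g z = z" for g z
    using affine_weyl_wandering[OF that(2)] that by metis
  show "torus_param z = torus_param w \<longleftrightarrow> (\<exists>g\<in>affine_weyl. w = g z)" for z w
    by (rule torus_param_eq_iff)
qed (fact base_regular affine_weyl_continuous affine_weyl_regular affine_weyl_comp affine_weyl_inverse)+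

lemma divisible_by_powers_zero:
  fixes c :: "complex \<times> complex"
  assumes "\<And>n. n \<ge> 1 \<Longrightarrow> \<exists>v\<in>\<int> \<times> \<int>. c = (- 2) ^ n *\<^sub>R v"
  shows "c = 0"
proof (rule ccontr)
  assume c: "c \<noteq> 0"
  obtain n where n: "norm c < 2 ^ n"
    using real_arch_pow[of 2 "norm c"] by auto
  \<comment> \<open>\<open>Suc n\<close> keeps the exponent at least 1, as the assumption demands. A
    nonzero lattice vector has norm at least 1, which would make c too long.\<close>
  obtain v where v: "v \<in> \<int> \<times> \<int>" "c = (- 2) ^ Suc n *\<^sub>R v"
    using assms[of "Suc n"] by auto
  have "1 \<le> norm v"
  proof -
    obtain j k where jk: "v = (of_int j, of_int k)"
      using v(1) by (auto elim!: Ints_cases)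
    then have "j \<noteq> 0 \<or> k \<noteq> 0"
      using c v by (auto simp: zero_prod_def)
    then have "1 \<le> norm (fst v) \<or> 1 \<le> norm (snd v)"
      by (auto simp: jk)
    then show ?thesis
      using norm_fst_le[of "fst v" "snd v"] norm_snd_le[of "snd v" "fst v"] by auto
  qed
  moreover have "norm c = 2 ^ Suc n * norm v"
    by (simp add: v(2) power_abs del: power_Suc)
  ultimately have "norm c \<ge> 2 ^ Suc n * 1"
    by (metis mult_left_mono zero_le_numeral zero_le_power)
  moreover have "0 < (2 :: real) ^ n" by simp
  ultimately show False
    using n by simp
qed

lemma affine_weyl_translation: "u \<in> \<int> \<times> \<int> \<Longrightarrow> (\<lambda>z. z + u) \<in> affine_weyl"
  using affine_weylI[OF weyl_id, of u] by simp

text \<open>The subgroups of the elements whose translation part is divisible by the n-th power of 2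
  intersect in the linear part, which contains no nontrivial normal subgroup.\<close>

lemma affine_weyl_core_trivial:
  assumes h: "h \<in> affine_weyl"
    and core: "\<And>n k. n \<ge> 1 \<Longrightarrow> k \<in> affine_weyl \<Longrightarrow>
      \<exists>\<sigma>\<in>weyl. \<exists>v\<in>\<int> \<times> \<int>. \<forall>z. k (h z) = \<sigma> (k z) + (- 2) ^ n *\<^sub>R v"
  shows "h = id"
proof -
  obtain \<tau> w where \<tau>: "\<tau> \<in> weyl" "w \<in> \<int> \<times> \<int>" "h = (\<lambda>z. \<tau> z + w)"
    using h by (rule affine_weylE)
  have "w = 0"
  proof (rule divisible_by_powers_zero)
    fix n :: nat assume n: "n \<ge> 1"
    \<comment> \<open>Conjugation by the identity, taken as the translation by 0, gives the
      divisibility of \<open>w\<close> itself.\<close>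
    have "0 \<in> \<int> \<times> (\<int> :: complex set)" by (simp add: zero_prod_def)
    from core[OF n affine_weyl_translation[OF this]]
    have "\<exists>\<sigma>\<in>weyl. \<exists>v\<in>\<int> \<times> \<int>. \<forall>z. h z = \<sigma> z + (- 2) ^ n *\<^sub>R v"
      unfolding add_0_right .
    then obtain \<sigma> v where *: "\<sigma> \<in> weyl" "v \<in> \<int> \<times> \<int>" "\<forall>z. h z = \<sigma> z + (- 2) ^ n *\<^sub>R v"
      by blast
    have "w = (- 2) ^ n *\<^sub>R v"
      using *(3)[rule_format, of 0] by (simp add: \<tau>(3) weyl_0[OF \<tau>(1)] weyl_0[OF *(1)])
    then show "\<exists>v\<in>\<int> \<times> \<int>. w = (- 2) ^ n *\<^sub>R v"
      using *(2) by blast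
  qed
  \<comment> \<open>Since \<open>w = 0\<close>, conjugating \<open>h\<close> by the translation by
    \<open>u\<close> gives the map with linear part \<open>\<tau>\<close> and translation part
    \<open>u - \<tau> u\<close>.\<close>
  have fix_lattice: "\<tau> u = u" if u: "u \<in> \<int> \<times> \<int>" for u
  proof -
    have "u - \<tau> u = 0"
    proof (rule divisible_by_powers_zero)
      fix n :: nat assume n: "n \<ge> 1"
      obtain \<sigma> v where *: "\<sigma> \<in> weyl" "v \<in> \<int> \<times> \<int>" "\<And>z. h z + u = \<sigma> (z + u) + (- 2) ^ n *\<^sub>R v"
        using core[OF n affine_weyl_translation[OF u]] by blast
      have 1: "\<tau> z + u = \<sigma> z + \<sigma> u + (- 2) ^ n *\<^sub>R v" for z
        using *(3)[of z] by (simp add: \<tau>(3) \<open>w = 0\<close> weyl_add[OF *(1)])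
      from 1[of 0] have 2: "u = \<sigma> u + (- 2) ^ n *\<^sub>R v"
        by (simp add: weyl_0 * \<tau>)
      with 1[of u] have "\<tau> u = \<sigma> u"
        by (metis add.assoc add_right_cancel)
      then have "u - \<tau> u = (- 2) ^ n *\<^sub>R v"
        using 2 by (metis add_diff_cancel_left')
      then show "\<exists>v\<in>\<int> \<times> \<int>. u - \<tau> u = (- 2) ^ n *\<^sub>R v"
        using *(2) by blast
    qed
    then show ?thesis by simp
  qed
  have fixed: "\<tau> (1, 0) = (1, 0)" "\<tau> (0, 1) = (0, 1)"
    by (rule fix_lattice; simp)+
  have "\<tau> = id"
    using \<tau>(1) fixed unfolding weyl_def by (elim insertE emptyE) (simp_all add: fun_eq_iff)
  then show ?thesis
    by (auto simp: \<tau>(3) \<open>w = 0\<close>)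
qed

text \<open>The loop has the lift \<open>k \<circ> l\<close> from the translate of the base point by
  \<open>k\<close>. On parameters the iterate is multiplication by (-2)^n, so dividing this lift by
  (-2)^n gives the lift through the iterate.\<close>

lemma deltoid_monodromy:
  assumes "\<eta> \<in> based_loops (- deltoid) (0, 0)" "deltoid_cover.is_lift \<eta> (1 / 3, 0) l" "k \<in> affine_weyl"
  shows "monodromy (deltoid_map ^^ n) (- deltoid) (0, 0) (loop_class (- deltoid) (0, 0) \<eta>)
      (torus_param ((1 / (- 2) ^ n) *\<^sub>R k (1 / 3, 0))) =
    torus_param ((1 / (- 2) ^ n) *\<^sub>R k (pathfinish l))"
proof -
  have "monodromy (deltoid_map ^^ n) (- deltoid) (0, 0) (loop_class (- deltoid) (0, 0) \<eta>)
      (torus_param ((1 / (- 2) ^ n) *\<^sub>R k (1 / 3, 0))) =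
    torus_param ((1 / (- 2) ^ n) *\<^sub>R pathfinish (k \<circ> l))"
  proof (rule deltoid_cover.monodromy_semiconjugate[where M = "\<lambda>z. (- 2) ^ n *\<^sub>R z"])
    show "(deltoid_map ^^ n) (torus_param z) = torus_param ((- 2) ^ n *\<^sub>R z)" for z
      by (rule deltoid_map_funpow)
    show "torus_param z \<in> - deltoid \<longleftrightarrow> z \<in> regular_points" for z
      using torus_param_deltoid by simp
    \<comment> \<open>Contrapositive: a root with an integral value keeps an integral value after
      multiplication by (-2)^n.\<close>
    show "z \<in> regular_points" if "(- 2) ^ n *\<^sub>R z \<in> regular_points" for z
    proof -
      obtain x y where z: "z = (x, y)" by (cases z)
      have m: "complex_of_real ((- 2) ^ n) \<in> \<int>" by simp
      have Im: "c \<notin> \<int>" if "complex_of_real ((- 2) ^ n) * c \<notin> \<int>" for c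
        using that m Ints_mult by blast
      show ?thesis
        using that Im[of "x - y"] Im[of "x + 2 * y"] Im[of "2 * x + y"]
        unfolding z regular_points_def scaleR_Pair scaleR_conv_of_real mem_Collect_eq prod.case
        by (simp only: distrib_left right_diff_distrib mult.left_commute) blast
    qed
    show "torus_param ((- 2) ^ n *\<^sub>R ((1 / (- 2) ^ n) *\<^sub>R k (1 / 3, 0))) = (0, 0)"
      using torus_param_eq_iff[of "(1 / 3, 0)" "k (1 / 3, 0)"] assms(3) torus_param_base by auto
    have "deltoid_cover.is_lift \<eta> (k (1 / 3, 0)) (k \<circ> l)"
      by (rule deltoid_cover.lift_deck[OF assms(3,2)])
    then show "deltoid_cover.is_lift \<eta> ((- 2) ^ n *\<^sub>R ((1 / (- 2) ^ n) *\<^sub>R k (1 / 3, 0))) (k \<circ> l)"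
      by simp
  qed (use assms(1) torus_param_surj torus_param_continuous in \<open>auto intro!: continuous_intros\<close>)
  then show ?thesis
    by (simp add: pathfinish_compose)
qed

text \<open>All fibre points have the form treated in \<open>deltoid_monodromy\<close>. A closed
  lift therefore fixes each of them; conversely, the fibre point indexed by \<open>k\<close>
  supplies the hypothesis of \<open>affine_weyl_core_trivial\<close> for the conjugate by
  \<open>k\<close>. The restricted identity is the unit of \<open>BijGroup\<close> on the
  fibre.\<close>

lemma deltoid_monodromy_trivial_iff:
  assumes \<eta>: "\<eta> \<in> based_loops (- deltoid) (0, 0)" and l: "deltoid_cover.is_lift \<eta> (1 / 3, 0) l"
  shows "(\<forall>n\<ge>1. monodromy (deltoid_map ^^ n) (- deltoid) (0, 0) (loop_class (- deltoid) (0, 0) \<eta>) =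
      (\<lambda>y\<in>(deltoid_map ^^ n) -` {(0, 0)}. y)) \<longleftrightarrow> pathfinish l = (1 / 3, 0)" (is "?L \<longleftrightarrow> ?R")
proof
  let ?c = "loop_class (- deltoid) (0, 0) \<eta>"
  assume R: ?R
  show ?L
  proof (intro allI impI)
    fix n :: nat
    show "monodromy (deltoid_map ^^ n) (- deltoid) (0, 0) ?c = (\<lambda>y\<in>(deltoid_map ^^ n) -` {(0, 0)}. y)"
    proof (rule extensionalityI)
      show "monodromy (deltoid_map ^^ n) (- deltoid) (0, 0) ?c \<in> extensional ((deltoid_map ^^ n) -` {(0, 0)})"
        by (simp add: monodromy_def)
      fix y assume y: "y \<in> (deltoid_map ^^ n) -` {(0, 0)}"
      obtain w where w: "y = torus_param w"
        using torus_param_surj by (meson surjD)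
      have "torus_param (1 / 3, 0) = torus_param ((- 2) ^ n *\<^sub>R w)"
        using y by (simp add: w torus_param_base deltoid_map_funpow)
      then obtain k where k: "k \<in> affine_weyl" "(- 2) ^ n *\<^sub>R w = k (1 / 3, 0)"
        using torus_param_eq_iff by blast
      have "w = (1 / (- 2) ^ n) *\<^sub>R k (1 / 3, 0)"
        unfolding k(2)[symmetric] by simp
      then show "monodromy (deltoid_map ^^ n) (- deltoid) (0, 0) ?c y = (\<lambda>y\<in>(deltoid_map ^^ n) -` {(0, 0)}. y) y"
        using deltoid_monodromy[OF \<eta> l k(1), of n] y by (simp add: R w)
    qed simp
  qed
next
  assume L: ?L
  have \<eta>': "\<eta> \<in> based_loops (- deltoid) (torus_param (1 / 3, 0))"
    using \<eta> by (simp add: torus_param_base)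
  note fin = deltoid_cover.lift_finish[OF l \<eta>']
  obtain h where h: "h \<in> affine_weyl" "pathfinish l = h (1 / 3, 0)"
    using torus_param_eq_iff[of "(1 / 3, 0)" "pathfinish l"] fin by auto
  have "h = id"
  proof (rule affine_weyl_core_trivial[OF h(1)])
    fix n k assume n: "1 \<le> (n :: nat)" and k: "k \<in> affine_weyl"
    let ?y = "(1 / (- 2) ^ n) *\<^sub>R k (1 / 3, 0)"
    have "torus_param (k (1 / 3, 0)) = (0, 0)"
      using torus_param_eq_iff[of "(1 / 3, 0)" "k (1 / 3, 0)"] k torus_param_base by auto
    then have "torus_param ?y \<in> (deltoid_map ^^ n) -` {(0, 0)}"
      by (simp add: deltoid_map_funpow)
    then have "torus_param ?y = torus_param ((1 / (- 2) ^ n) *\<^sub>R k (pathfinish l))"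
      using deltoid_monodromy[OF \<eta> l k, of n] L n by simp
    then obtain g where "g \<in> affine_weyl" "(1 / (- 2) ^ n) *\<^sub>R k (pathfinish l) = g ?y"
      unfolding torus_param_eq_iff by blast
    then obtain \<sigma> v where \<sigma>: "\<sigma> \<in> weyl" "v \<in> \<int> \<times> \<int>" "(1 / (- 2) ^ n) *\<^sub>R k (pathfinish l) = \<sigma> ?y + v"
      by (metis affine_weylE)
    \<comment> \<open>Scaling back commutes with the linear \<open>\<sigma>\<close> but multiplies
      the integral \<open>v\<close>: the divisibility by (-2)^n arises here.\<close>
    have "k (pathfinish l) = (- 2) ^ n *\<^sub>R (1 / (- 2) ^ n) *\<^sub>R k (pathfinish l)"
      by simp
    also have "\<dots> = \<sigma> (k (1 / 3, 0)) + (- 2) ^ n *\<^sub>R v"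
      unfolding \<sigma>(3) by (simp add: scaleR_right_distrib weyl_scaleR[OF \<sigma>(1)])
    finally have 1: "k (pathfinish l) = \<sigma> (k (1 / 3, 0)) + (- 2) ^ n *\<^sub>R v" .
    let ?s = "\<lambda>z. \<sigma> z + (- 2) ^ n *\<^sub>R v"
    have "(- 2) ^ n *\<^sub>R v \<in> \<int> \<times> \<int>"
      using \<sigma>(2) by (cases v) (auto simp: scaleR_conv_of_real intro!: Ints_mult)
    then have s: "?s \<in> affine_weyl"
      by (rule affine_weylI[OF \<sigma>(1)])
    \<comment> \<open>Both sides agree at the base point, and freeness of the action spreads this to
      all points.\<close>
    have "k \<circ> h = ?s \<circ> k"
      by (rule deltoid_cover.deck_unique[OF affine_weyl_comp[OF k h(1)] affine_weyl_comp[OF s k] base_regular])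
        (use 1 h(2) in simp)
    then show "\<exists>\<sigma>\<in>weyl. \<exists>v\<in>\<int> \<times> \<int>. \<forall>z. k (h z) = \<sigma> (k z) + (- 2) ^ n *\<^sub>R v"
      using \<sigma>(1,2) by (metis comp_apply)
  qed
  then show ?R
    using h(2) by simp
qed

lemma deltoid_monodromy_kernel:
  "monodromy_kernel deltoid_map (- deltoid) (0, 0) =
    {c \<in> carrier (fundamental_group (- deltoid) (0, 0)). deltoid_cover.deck c = id}"
proof -
  have "c \<in> monodromy_kernel deltoid_map (- deltoid) (0, 0) \<longleftrightarrow> deltoid_cover.deck c = id"
    if c: "c \<in> carrier (fundamental_group (- deltoid) (0, 0))" for c
  proof -
    obtain \<eta> where \<eta>: "\<eta> \<in> based_loops (- deltoid) (0, 0)" "c = loop_class (- deltoid) (0, 0) \<eta>"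
      using c unfolding carrier_fundamental_group by blast
    obtain l g where l: "deltoid_cover.is_lift \<eta> (1 / 3, 0) l" "g \<in> affine_weyl" "g (pathfinish l) = (1 / 3, 0)"
      using deltoid_cover.deck_obtain[of \<eta>] \<eta>(1) unfolding torus_param_base by blast
    have "deltoid_cover.deck c = g"
      using deltoid_cover.deck_eqI[of \<eta> l g] \<eta> l unfolding torus_param_base by blast
    moreover have "g = id \<longleftrightarrow> pathfinish l = (1 / 3, 0)"
      using l deltoid_cover.free[OF l(2) base_regular] by auto
    ultimately show ?thesis
      using deltoid_monodromy_trivial_iff[OF \<eta>(1) l(1)] c
      by (auto simp: monodromy_kernel_def kernel_def BijGroup_def \<eta>(2))
  qed
  moreover have "monodromy_kernel deltoid_map (- deltoid) (0, 0) \<subseteq> carrier (fundamental_group (- deltoid) (0, 0))"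
    by (auto simp: monodromy_kernel_def kernel_def)
  ultimately show ?thesis by blast
qed

section \<open>Generation by reflections\<close>

text \<open>Their fixed lines x = y, x + 2 y = 0 and 2 x + y = 1 bound a fundamental triangle in the
  real plane; the third is the affine generator.\<close>

definition simple_reflections :: "(complex \<times> complex \<Rightarrow> complex \<times> complex) set"
  where "simple_reflections = {\<lambda>(x, y). (y, x), \<lambda>(x, y). (x, - x - y), \<lambda>(x, y). (1 - x - y, y)}"

lemma simple_reflections_subset: "simple_reflections \<subseteq> affine_weyl"
proof -
  have "(\<lambda>z. \<sigma> z + v) \<in> affine_weyl" if "\<sigma> \<in> weyl" "v \<in> \<int> \<times> \<int>" for \<sigma> v
    using that by (rule affine_weylI)
  from this[of "\<lambda>(x, y). (y, x)" "(0, 0)"] this[of "\<lambda>(x, y). (x, - x - y)" "(0, 0)"]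
    this[of "\<lambda>(x, y). (- x - y, y)" "(1, 0)"]
  show ?thesis
    by (simp add: simple_reflections_def weyl_def case_prod_unfold plus_prod_def algebra_simps)
qed

text \<open>Closure under composition is enough because the generators are involutions. It serves
  twice: for the image of \<open>deck\<close> and for the identification with the reflection group
  of the triangle.\<close>

lemma affine_weyl_generated:
  assumes simple: "simple_reflections \<subseteq> K" and comp: "\<And>g h. g \<in> K \<Longrightarrow> h \<in> K \<Longrightarrow> g \<circ> h \<in> K"
  shows "affine_weyl \<subseteq> K"
proof
  let ?s1 = "\<lambda>(x, y). (y, x) :: complex \<times> complex"
  let ?s2 = "\<lambda>(x, y). (x, - x - y) :: complex \<times> complex"
  let ?s3 = "\<lambda>(x, y). (1 - x - y, y) :: complex \<times> complex"
  have s: "?s1 \<in> K" "?s2 \<in> K" "?s3 \<in> K"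
    using simple by (simp_all add: simple_reflections_def)
  have 1: "f \<in> K" if "g \<in> K" "h \<in> K" "f = g \<circ> h" for f g h
    using comp that by simp
  have i: "id \<in> K" by (rule 1[OF s(1) s(1)]) auto
  have w4: "(\<lambda>(x, y). (y, - x - y)) \<in> K" by (rule 1[OF s(2) s(1)]) auto
  have w5: "(\<lambda>(x, y). (- x - y, x)) \<in> K" by (rule 1[OF s(1) s(2)]) auto
  have w3: "(\<lambda>(x, y). (- x - y, y)) \<in> K" by (rule 1[OF s(1) w4]) auto
  have weyl: "weyl \<subseteq> K"
    using s w3 w4 w5 i by (simp add: weyl_def id_def case_prod_unfold)
  \<comment> \<open>The affine reflection and the linear one with parallel fixed line differ by a
    unit translation; the two orders of composition give both directions.\<close>
  have p: "(\<lambda>z. z + (1, 0)) \<in> K" by (rule 1[OF s(3) w3]) auto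
  have m: "(\<lambda>z. z + (- 1, 0)) \<in> K" by (rule 1[OF w3 s(3)]) auto
  have x: "(\<lambda>z. z + (of_int n, 0)) \<in> K" for n
  proof (induction n rule: int_induct[of _ 0])
    case base
    have "(\<lambda>z. z + (of_int 0, 0)) = (id :: complex \<times> complex \<Rightarrow> _)" by auto
    then show ?case using i by simp
  next
    case (step1 n)
    show ?case by (rule 1[OF p step1(2)]) auto
  next
    case (step2 n)
    show ?case by (rule 1[OF m step2(2)]) auto
  qed
  have y: "(\<lambda>z. z + (0, of_int n)) \<in> K" for n
    by (rule 1[OF 1[OF s(1) x[of n] refl] s(1)]) auto
  fix g assume "g \<in> affine_weyl"
  then obtain \<sigma> v where g: "\<sigma> \<in> weyl" "v \<in> \<int> \<times> \<int>" "g = (\<lambda>z. \<sigma> z + v)"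
    by (rule affine_weylE)
  obtain j k where jk: "v = (of_int j, of_int k)"
    using g(2) by (auto elim!: Ints_cases)
  have "\<sigma> \<in> K" using g(1) weyl by blast
  then show "g \<in> K"
    by (rule 1[OF 1[OF x[of j] y[of k] refl]]) (auto simp: g jk fun_eq_iff)
qed

section \<open>Half turns around the reflection lines and surjectivity of
  \<open>deck\<close>\<close>

lemma norm_third_not_Ints: "norm \<zeta> = 1 / 3 \<Longrightarrow> \<zeta> \<notin> \<int>" for \<zeta> :: complex
proof
  assume *: "norm \<zeta> = 1 / 3" "\<zeta> \<in> \<int>"
  then obtain k where k: "\<zeta> = of_int k" by (auto elim: Ints_cases)
  have "norm \<zeta> = real_of_int \<bar>k\<bar>" by (simp add: k)
  then have "real_of_int \<bar>k\<bar> * 3 = 1" using *(1) by linarith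
  then have "real_of_int (\<bar>k\<bar> * 3) = of_int 1"
    unfolding of_int_mult of_int_numeral of_int_1 .
  then have "\<bar>k\<bar> * 3 = 1" unfolding of_int_eq_iff .
  then show False by presburger
qed

text \<open>A half turn of \<zeta> around 0 on the circle of radius 1/3 moves the base point around
  one of the three complex lines fixed by the simple reflections.\<close>

lemma half_circle_regular:
  assumes "norm \<zeta> = 1 / 3"
  shows "(1 / 6 + \<zeta> / 2, 1 / 6 - \<zeta> / 2) \<in> regular_points" "(1 / 3, \<zeta> / 2 - 1 / 6) \<in> regular_points"
    "((1 - \<zeta>) / 2, 0) \<in> regular_points"
proof -
  have 0: "\<zeta> \<notin> \<int>" by (rule norm_third_not_Ints[OF assms])
  have 1: "(1 - \<zeta>) / 2 \<notin> \<int>"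
  proof
    assume "(1 - \<zeta>) / 2 \<in> \<int>"
    then have "1 - 2 * ((1 - \<zeta>) / 2) \<in> \<int>" by (intro Ints_diff Ints_mult) auto
    moreover have "1 - 2 * ((1 - \<zeta>) / 2) = \<zeta>" by (simp add: field_simps)
    ultimately show False using 0 by (simp only:)
  qed
  have 2: "(1 + \<zeta>) / 2 \<notin> \<int>"
  proof
    assume "(1 + \<zeta>) / 2 \<in> \<int>"
    then have "2 * ((1 + \<zeta>) / 2) - 1 \<in> \<int>" by (intro Ints_diff Ints_mult) auto
    moreover have "2 * ((1 + \<zeta>) / 2) - 1 = \<zeta>" by (simp add: field_simps)
    ultimately show False using 0 by (simp only:)
  qed
  have 3: "1 - \<zeta> \<notin> \<int>"
  proof
    assume "1 - \<zeta> \<in> \<int>"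
    then have "1 - (1 - \<zeta>) \<in> \<int>" by (intro Ints_diff) auto
    then show False using 0 by simp
  qed
  have "1 / 6 + \<zeta> / 2 - (1 / 6 - \<zeta> / 2) = \<zeta>" "1 / 6 + \<zeta> / 2 + 2 * (1 / 6 - \<zeta> / 2) = (1 - \<zeta>) / 2"
    "2 * (1 / 6 + \<zeta> / 2) + (1 / 6 - \<zeta> / 2) = (1 + \<zeta>) / 2"
    by (simp_all add: field_simps)
  then show "(1 / 6 + \<zeta> / 2, 1 / 6 - \<zeta> / 2) \<in> regular_points"
    using 0 1 2 by (simp only: regular_points_def mem_Collect_eq prod.case) blast
  have "1 / 3 - (\<zeta> / 2 - 1 / 6) = (1 - \<zeta>) / 2" "1 / 3 + 2 * (\<zeta> / 2 - 1 / 6) = \<zeta>"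
    "2 * (1 / 3) + (\<zeta> / 2 - 1 / 6) = (1 + \<zeta>) / 2"
    by (simp_all add: field_simps)
  then show "(1 / 3, \<zeta> / 2 - 1 / 6) \<in> regular_points"
    using 0 1 2 by (simp only: regular_points_def mem_Collect_eq prod.case) blast
  have "(1 - \<zeta>) / 2 - 0 = (1 - \<zeta>) / 2" "(1 - \<zeta>) / 2 + 2 * 0 = (1 - \<zeta>) / 2"
    "2 * ((1 - \<zeta>) / 2) + 0 = 1 - \<zeta>"
    by simp_all
  then show "((1 - \<zeta>) / 2, 0) \<in> regular_points"
    using 1 3 by (simp only: regular_points_def mem_Collect_eq prod.case) blast
qed

lemma group_hom_deck:
  "group_hom (fundamental_group (- deltoid) (0, 0)) (BijGroup UNIV) deltoid_cover.deck"
proof -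
  have "(0, 0) \<in> - deltoid"
    using torus_param_deltoid[of "(1 / 3, 0)"] base_regular torus_param_base by simp
  then show ?thesis
    using deltoid_cover.deck_hom unfolding torus_param_base
    by (intro group_hom.intro group_hom_axioms.intro group_fundamental_group group_BijGroup)
qed

text \<open>The forms x - y, x + 2 y and 1 - 2 x - y vanish on the three fixed lines and equal 1/3
  at the base point. Each path makes one of them equal to \<open>\<zeta> t\<close>, moving only
  along the (-1)-eigenvector of the reflection, so it ends at the mirror image of the base
  point.\<close>

lemma simple_reflection_deck:
  assumes "s \<in> simple_reflections"
  shows "s \<in> deltoid_cover.deck ` carrier (fundamental_group (- deltoid) (0, 0))"
proof -
  define \<zeta> where "\<zeta> t = exp (pi * \<i> * of_real t) / 3" for t
  have norm_\<zeta>: "norm (\<zeta> t) = 1 / 3" for t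
    by (simp add: \<zeta>_def norm_divide)
  have \<zeta>01: "\<zeta> 0 = 1 / 3" "\<zeta> 1 = - (1 / 3)"
    by (simp_all add: \<zeta>_def)
  have cont: "continuous_on A \<zeta>" for A
    unfolding \<zeta>_def by (intro continuous_intros) simp
  have sub: "path_image l \<subseteq> regular_points" if "\<And>t. l t \<in> regular_points" for l :: "real \<Rightarrow> _"
    using that by (auto simp: path_image_def)
  have sW: "s \<in> affine_weyl"
    using assms simple_reflections_subset by blast
  have "\<exists>l. path l \<and> path_image l \<subseteq> regular_points \<and> pathstart l = (1 / 3, 0) \<and> s (pathfinish l) = (1 / 3, 0)"
  proof -
    from assms consider "s = (\<lambda>(x, y). (y, x))" | "s = (\<lambda>(x, y). (x, - x - y))" | "s = (\<lambda>(x, y). (1 - x - y, y))"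
      unfolding simple_reflections_def by blast
    then show ?thesis
    proof cases
      case 1
      have "path (\<lambda>t. (1 / 6 + \<zeta> t / 2, 1 / 6 - \<zeta> t / 2))"
        unfolding path_def by (intro continuous_intros cont) simp_all
      then show ?thesis
        using sub[OF half_circle_regular(1)[OF norm_\<zeta>]]
        by (intro exI[of _ "\<lambda>t. (1 / 6 + \<zeta> t / 2, 1 / 6 - \<zeta> t / 2)"])
          (auto simp: 1 pathstart_def pathfinish_def \<zeta>01)
    next
      case 2
      have "path (\<lambda>t. (1 / 3, \<zeta> t / 2 - 1 / 6))"
        unfolding path_def by (intro continuous_intros cont) simp_all
      then show ?thesis
        using sub[OF half_circle_regular(2)[OF norm_\<zeta>]]
        by (intro exI[of _ "\<lambda>t. (1 / 3, \<zeta> t / 2 - 1 / 6)"])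
          (auto simp: 2 pathstart_def pathfinish_def \<zeta>01)
    next
      case 3
      have "path (\<lambda>t. ((1 - \<zeta> t) / 2, 0 :: complex))"
        unfolding path_def by (intro continuous_intros cont) simp_all
      then show ?thesis
        using sub[OF half_circle_regular(3)[OF norm_\<zeta>]]
        by (intro exI[of _ "\<lambda>t. ((1 - \<zeta> t) / 2, 0)"])
          (auto simp: 3 pathstart_def pathfinish_def \<zeta>01)
    qed
  qed
  then show ?thesis
    using deltoid_cover.deck_surj[OF sW] unfolding torus_param_base by blast
qed

lemma deck_image:
  "deltoid_cover.deck ` carrier (fundamental_group (- deltoid) (0, 0)) = affine_weyl"
proof
  interpret group_hom "fundamental_group (- deltoid) (0, 0)" "BijGroup UNIV" deltoid_cover.deck
    by (rule group_hom_deck)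
  let ?G = "fundamental_group (- deltoid) (0, 0)"
  show "deltoid_cover.deck ` carrier ?G \<subseteq> affine_weyl"
    using deltoid_cover.deck_in unfolding torus_param_base by blast
  show "affine_weyl \<subseteq> deltoid_cover.deck ` carrier ?G"
  proof (rule affine_weyl_generated)
    show "simple_reflections \<subseteq> deltoid_cover.deck ` carrier ?G"
      using simple_reflection_deck by blast
    fix g h assume "g \<in> deltoid_cover.deck ` carrier ?G" "h \<in> deltoid_cover.deck ` carrier ?G"
    then obtain c d where c: "c \<in> carrier ?G" "g = deltoid_cover.deck c"
      and d: "d \<in> carrier ?G" "h = deltoid_cover.deck d" by blast
    have "bij g" "bij h"
      using hom_closed[OF c(1)] hom_closed[OF d(1)] c d by (simp_all add: BijGroup_UNIV_simps)
    then have "g \<circ> h = deltoid_cover.deck (c \<otimes>\<^bsub>?G\<^esub> d)"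
      using hom_mult[OF c(1) d(1)] c d by (simp add: BijGroup_UNIV_simps)
    then show "g \<circ> h \<in> deltoid_cover.deck ` carrier ?G"
      using c d by blast
  qed
qed

section \<open>Reflections of an equilateral triangle in barycentric coordinates\<close>

lemma reflection_across_side:
  fixes a b c :: "'a::euclidean_space"
  assumes abc: "equilateral a b c" and sum: "\<alpha> + \<beta> + \<gamma> = 1"
  shows "reflection_across (affine hull {a, b}) (\<alpha> *\<^sub>R a + \<beta> *\<^sub>R b + \<gamma> *\<^sub>R c) =
    (\<alpha> + \<gamma>) *\<^sub>R a + (\<beta> + \<gamma>) *\<^sub>R b - \<gamma> *\<^sub>R c"
proof -
  define z where "z = \<alpha> *\<^sub>R a + \<beta> *\<^sub>R b + \<gamma> *\<^sub>R c"
  \<comment> \<open>The foot of the perpendicular: the apex c projects to the midpoint of a and b,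
    so its weight \<open>\<gamma>\<close> is shared equally between them.\<close>
  define q where "q = (\<alpha> + \<gamma> / 2) *\<^sub>R a + (\<beta> + \<gamma> / 2) *\<^sub>R b"
  have "norm (c - a) ^ 2 = norm (c - b) ^ 2"
    using abc by (simp add: equilateral_def dist_norm norm_minus_commute)
  then have orth: "(c - (1 / 2) *\<^sub>R a - (1 / 2) *\<^sub>R b) \<bullet> (b - a) = 0"
    unfolding power2_norm_eq_inner by (simp add: algebra_simps inner_commute)
  have zq: "z - q = \<gamma> *\<^sub>R (c - (1 / 2) *\<^sub>R a - (1 / 2) *\<^sub>R b)"
    by (simp add: z_def q_def algebra_simps)
  have "closest_point (affine hull {a, b}) z = q"
  proof (rule closest_point_unique[symmetric])
    show "convex (affine hull {a, b})" "closed (affine hull {a, b})"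
      by (simp_all add: affine_imp_convex)
    show "q \<in> affine hull {a, b}"
      unfolding affine_hull_2 q_def using sum
      by (intro CollectI exI[of _ "\<alpha> + \<gamma> / 2"] exI[of _ "\<beta> + \<gamma> / 2"] conjI refl) simp
    show "\<forall>y\<in>affine hull {a, b}. dist z q \<le> dist z y"
    proof
      fix y assume "y \<in> affine hull {a, b}"
      then obtain u v where y: "y = u *\<^sub>R a + v *\<^sub>R b" "u + v = 1"
        by (auto simp: affine_hull_2)
      define s where "s = \<beta> + \<gamma> / 2 - v"
      have u: "\<alpha> + \<gamma> / 2 - u = - s"
        using sum y(2) by (simp add: s_def)
      have "q - y = (\<alpha> + \<gamma> / 2 - u) *\<^sub>R a + s *\<^sub>R b"
        by (simp add: q_def y s_def algebra_simps)
      then have qy: "q - y = s *\<^sub>R (b - a)"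
        unfolding u by (simp add: algebra_simps)
      have "orthogonal (z - q) (q - y)"
        by (simp add: orthogonal_def zq qy orth)
      from norm_add_Pythagorean[OF this]
      have "(norm (z - q))\<^sup>2 \<le> (norm (z - y))\<^sup>2" by simp
      then show "dist z q \<le> dist z y"
        unfolding dist_norm by (rule power2_le_imp_le) simp
    qed
  qed
  moreover have "2 *\<^sub>R q = (2 * \<alpha> + \<gamma>) *\<^sub>R a + (2 * \<beta> + \<gamma>) *\<^sub>R b"
    by (simp add: q_def scaleR_add_right distrib_left)
  moreover have "(2 * \<alpha> + \<gamma>) *\<^sub>R a = (\<alpha> + \<gamma>) *\<^sub>R a + \<alpha> *\<^sub>R a"
    "(2 * \<beta> + \<gamma>) *\<^sub>R b = (\<beta> + \<gamma>) *\<^sub>R b + \<beta> *\<^sub>R b"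
    unfolding scaleR_left_distrib[symmetric] by simp_all
  ultimately show ?thesis
    unfolding reflection_across_def z_def[symmetric] by (simp add: z_def)
qed

lemma equilateral_rotate: "equilateral a b c \<Longrightarrow> equilateral b c a"
  by (auto simp: equilateral_def)

lemma barycentric_coordinates:
  fixes a b c :: "real^2"
  assumes "equilateral a b c"
  obtains f g where "\<And>z. z = f z *\<^sub>R a + g z *\<^sub>R b + (1 - f z - g z) *\<^sub>R c"
    and "\<And>\<alpha> \<beta>. f (\<alpha> *\<^sub>R a + \<beta> *\<^sub>R b + (1 - \<alpha> - \<beta>) *\<^sub>R c) = \<alpha>"
    and "\<And>\<alpha> \<beta>. g (\<alpha> *\<^sub>R a + \<beta> *\<^sub>R b + (1 - \<alpha> - \<beta>) *\<^sub>R c) = \<beta>"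
proof -
  define u1 u2 v1 v2 where uv: "u1 = a$1 - c$1" "u2 = a$2 - c$2" "v1 = b$1 - c$1" "v2 = b$2 - c$2"
  \<comment> \<open>The determinant in Cramer's rule for the edge vectors from c.\<close>
  define D where "D = u1 * v2 - u2 * v1"
  have sq: "(dist x y)\<^sup>2 = (x$1 - y$1)\<^sup>2 + (x$2 - y$2)\<^sup>2" for x y :: "real^2"
    by (simp add: dist_norm norm_eq_sqrt_inner inner_vec_def sum_2 power2_eq_square)
  have eq: "(dist a b)\<^sup>2 = (dist b c)\<^sup>2" "(dist b c)\<^sup>2 = (dist c a)\<^sup>2" and ab: "dist a b \<noteq> 0"
    using assms by (auto simp: equilateral_def)
  have d: "u1\<^sup>2 + u2\<^sup>2 = v1\<^sup>2 + v2\<^sup>2" "(u1 - v1)\<^sup>2 + (u2 - v2)\<^sup>2 = v1\<^sup>2 + v2\<^sup>2"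
    using eq unfolding sq uv by (simp_all add: power2_eq_square algebra_simps)
  have pos: "v1\<^sup>2 + v2\<^sup>2 \<noteq> 0"
    using ab eq sq[of b c] uv by auto
  have "D \<noteq> 0"
  proof
    assume "D = 0"
    \<comment> \<open>Equal sides make the inner product half the squared side S (the angle is 60
      degrees). If D = 0, Lagrange's identity then reads S^2 = 4 S^2.\<close>
    have ip: "2 * (u1 * v1 + u2 * v2) = v1\<^sup>2 + v2\<^sup>2"
      using d by (simp add: power2_eq_square algebra_simps)
    have "4 * D\<^sup>2 + (2 * (u1 * v1 + u2 * v2))\<^sup>2 = 4 * (u1\<^sup>2 + u2\<^sup>2) * (v1\<^sup>2 + v2\<^sup>2)"
      by (simp add: D_def power2_eq_square algebra_simps)
    moreover define S where "S = v1\<^sup>2 + v2\<^sup>2"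
    ultimately have "4 * 0\<^sup>2 + S\<^sup>2 = 4 * S * S"
      unfolding ip d(1) \<open>D = 0\<close> by (simp only:)
    then have "S = 0" by (simp add: power2_eq_square)
    then show False using pos unfolding S_def by blast
  qed
  define f where "f z = ((z$1 - c$1) * v2 - (z$2 - c$2) * v1) / D" for z :: "real^2"
  define g where "g z = (u1 * (z$2 - c$2) - u2 * (z$1 - c$1)) / D" for z :: "real^2"
  have a12: "a$1 = u1 + c$1" "a$2 = u2 + c$2" "b$1 = v1 + c$1" "b$2 = v2 + c$2"
    by (simp_all add: uv)
  show ?thesis
  proof
    fix z :: "real^2"
    define p q where pq: "p = z$1 - c$1" "q = z$2 - c$2"
    have 1: "D * p = (p * v2 - q * v1) * u1 + (u1 * q - u2 * p) * v1"
      "D * q = (p * v2 - q * v1) * u2 + (u1 * q - u2 * p) * v2"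
      by (simp_all add: D_def algebra_simps)
    have fg: "f z = (p * v2 - q * v1) / D" "g z = (u1 * q - u2 * p) / D"
      by (simp_all add: f_def g_def pq)
    have 2: "p = f z * u1 + g z * v1" "q = f z * u2 + g z * v2"
    proof -
      have "p = D * p / D" "q = D * q / D" using \<open>D \<noteq> 0\<close> by simp_all
      then show "p = f z * u1 + g z * v1" "q = f z * u2 + g z * v2"
        unfolding 1 fg by (simp_all add: add_divide_distrib)
    qed
    have "z$1 = p + c$1" "z$2 = q + c$2" by (simp_all add: pq)
    then have "z$1 = f z * a$1 + g z * b$1 + (1 - f z - g z) * c$1"
      "z$2 = f z * a$2 + g z * b$2 + (1 - f z - g z) * c$2"
      unfolding 2 a12 by (simp_all only:) (simp_all add: algebra_simps)
    then show "z = f z *\<^sub>R a + g z *\<^sub>R b + (1 - f z - g z) *\<^sub>R c"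
      by (simp add: vec_eq_iff forall_2)
  next
    fix \<alpha> \<beta>
    have "((\<alpha> * u1 + \<beta> * v1) * v2 - (\<alpha> * u2 + \<beta> * v2) * v1) = \<alpha> * D"
      "(u1 * (\<alpha> * u2 + \<beta> * v2) - u2 * (\<alpha> * u1 + \<beta> * v1)) = \<beta> * D"
      by (simp_all add: D_def algebra_simps)
    moreover have "(\<alpha> *\<^sub>R a + \<beta> *\<^sub>R b + (1 - \<alpha> - \<beta>) *\<^sub>R c)$1 - c$1 = \<alpha> * u1 + \<beta> * v1"
      "(\<alpha> *\<^sub>R a + \<beta> *\<^sub>R b + (1 - \<alpha> - \<beta>) *\<^sub>R c)$2 - c$2 = \<alpha> * u2 + \<beta> * v2"
      by (simp_all add: a12 algebra_simps)
    ultimately show "f (\<alpha> *\<^sub>R a + \<beta> *\<^sub>R b + (1 - \<alpha> - \<beta>) *\<^sub>R c) = \<alpha>"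
      "g (\<alpha> *\<^sub>R a + \<beta> *\<^sub>R b + (1 - \<alpha> - \<beta>) *\<^sub>R c) = \<beta>"
      unfolding f_def g_def using \<open>D \<noteq> 0\<close> by simp_all
  qed
qed

section \<open>The affine Weyl group as a group of transformations of the real plane\<close>

lemma affine_weyl_real:
  assumes "g \<in> affine_weyl" "w \<in> \<real> \<times> \<real>"
  shows "g w \<in> \<real> \<times> \<real>"
proof -
  obtain \<sigma> v where g: "\<sigma> \<in> weyl" "v \<in> \<int> \<times> \<int>" "g = (\<lambda>z. \<sigma> z + v)"
    using assms(1) by (rule affine_weylE)
  obtain j k where "v = (of_int j, of_int k)"
    using g(2) by (auto elim!: Ints_cases)
  moreover have "\<sigma> w \<in> \<real> \<times> \<real>"
    using g(1) assms(2) unfolding weyl_def by auto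
  ultimately show ?thesis
    unfolding g(3) by (cases "\<sigma> w") auto
qed

text \<open>\<open>\<psi>\<close> transports the action on real points. Multiplicativity rests on
  real points being preserved, because \<open>A\<close> undoes \<open>B\<close> on them;
  faithfulness holds because the base point is real and regular.\<close>

lemma affine_weyl_embedding:
  fixes B :: "complex \<times> complex \<Rightarrow> 'a"
  assumes AR: "\<And>z. A z \<in> \<real> \<times> \<real>" and BA: "\<And>z. B (A z) = z"
    and AB_real: "\<forall>w\<in>\<real> \<times> \<real>. A (B w) = w"
  defines "\<psi> \<equiv> \<lambda>g z. B (g (A z))"
  shows "g \<in> affine_weyl \<Longrightarrow> h \<in> affine_weyl \<Longrightarrow> \<psi> (g \<circ> h) = \<psi> g \<circ> \<psi> h"
    and "\<psi> id = id"
    and "g \<in> affine_weyl \<Longrightarrow> bij (\<psi> g)"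
    and "g \<in> affine_weyl \<Longrightarrow> \<psi> g = id \<Longrightarrow> g = id"
    and "subgroup (\<psi> ` affine_weyl) (BijGroup UNIV)"
proof -
  note AB = bspec[OF AB_real]
  note R = affine_weyl_real[OF _ AR]
  have comp: "\<psi> (g \<circ> h) = \<psi> g \<circ> \<psi> h" if "g \<in> affine_weyl" "h \<in> affine_weyl" for g h
    using AB[OF R[OF that(2)]] by (auto simp: \<psi>_def)
  have id: "\<psi> id = id"
    by (auto simp: \<psi>_def BA)
  have inv: "\<exists>h\<in>affine_weyl. \<psi> h \<circ> \<psi> g = id \<and> \<psi> g \<circ> \<psi> h = id" if g: "g \<in> affine_weyl" for g
  proof -
    obtain h where h: "h \<in> affine_weyl" "h \<circ> g = id" "g \<circ> h = id"
      using affine_weyl_inverse[OF g] by blast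
    then show ?thesis
      using comp[OF g h(1)] comp[OF h(1) g] id by metis
  qed
  have bij: "bij (\<psi> g)" if "g \<in> affine_weyl" for g
    using inv[OF that] o_bij by metis
  show "subgroup (\<psi> ` affine_weyl) (BijGroup UNIV)"
  proof (rule group.subgroupI[OF group_BijGroup])
    show "\<psi> ` affine_weyl \<subseteq> carrier (BijGroup UNIV)"
      using bij by (auto simp: BijGroup_UNIV_simps)
    show "\<psi> ` affine_weyl \<noteq> {}"
      using simple_reflections_subset by (auto simp: simple_reflections_def)
    fix x assume "x \<in> \<psi> ` affine_weyl"
    then obtain g where g: "g \<in> affine_weyl" "x = \<psi> g" by blast
    obtain h where h: "h \<in> affine_weyl" "\<psi> h \<circ> \<psi> g = id"
      using inv[OF g(1)] by blast
    have "inv\<^bsub>BijGroup UNIV\<^esub> x = \<psi> h"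
      by (rule group.inv_equality[OF group_BijGroup]) (use g h bij in \<open>simp_all add: BijGroup_UNIV_simps\<close>)
    then show "inv\<^bsub>BijGroup UNIV\<^esub> x \<in> \<psi> ` affine_weyl"
      using h by blast
  next
    fix x y assume "x \<in> \<psi> ` affine_weyl" "y \<in> \<psi> ` affine_weyl"
    then obtain g h where gh: "g \<in> affine_weyl" "x = \<psi> g" "h \<in> affine_weyl" "y = \<psi> h" by blast
    then have "x \<otimes>\<^bsub>BijGroup UNIV\<^esub> y = \<psi> (g \<circ> h)"
      using bij comp by (simp add: BijGroup_UNIV_simps)
    then show "x \<otimes>\<^bsub>BijGroup UNIV\<^esub> y \<in> \<psi> ` affine_weyl"
      using gh affine_weyl_comp by blast
  qed
  show "g = id" if g: "g \<in> affine_weyl" and "\<psi> g = id"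
  proof -
    have real: "(1 / 3, 0) \<in> (\<real> :: complex set) \<times> (\<real> :: complex set)" by auto
    have "B (g (A (B (1 / 3, 0)))) = B (1 / 3, 0)"
      using that(2) unfolding \<psi>_def by (metis id_apply)
    then have "B (g (1 / 3, 0)) = B (1 / 3, 0)"
      unfolding AB[OF real] .
    then have "g (1 / 3, 0) = (1 / 3, 0)"
      using AB[OF real] AB[OF affine_weyl_real[OF g real]] by metis
    then show ?thesis
      by (rule deltoid_cover.free[OF g base_regular])
  qed
  show "g \<in> affine_weyl \<Longrightarrow> h \<in> affine_weyl \<Longrightarrow> \<psi> (g \<circ> h) = \<psi> g \<circ> \<psi> h"
    and "\<psi> id = id" and "g \<in> affine_weyl \<Longrightarrow> bij (\<psi> g)"
    by (fact comp id bij)+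
qed

lemma affine_weyl_triangle:
  fixes a b c :: "real^2"
  assumes abc: "equilateral a b c"
  obtains \<psi> where "\<And>g h. g \<in> affine_weyl \<Longrightarrow> h \<in> affine_weyl \<Longrightarrow> \<psi> (g \<circ> h) = \<psi> g \<circ> \<psi> h"
    and "\<psi> id = id" and "\<And>g. g \<in> affine_weyl \<Longrightarrow> bij (\<psi> g)"
    and "\<And>g. g \<in> affine_weyl \<Longrightarrow> \<psi> g = id \<Longrightarrow> g = id"
    and "\<psi> ` affine_weyl = carrier (triangle_reflection_group a b c)"
proof -
  obtain f1 f2 where f: "\<And>z. z = f1 z *\<^sub>R a + f2 z *\<^sub>R b + (1 - f1 z - f2 z) *\<^sub>R c"
    and f1: "\<And>\<alpha> \<beta>. f1 (\<alpha> *\<^sub>R a + \<beta> *\<^sub>R b + (1 - \<alpha> - \<beta>) *\<^sub>R c) = \<alpha>"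
    and f2: "\<And>\<alpha> \<beta>. f2 (\<alpha> *\<^sub>R a + \<beta> *\<^sub>R b + (1 - \<alpha> - \<beta>) *\<^sub>R c) = \<beta>"
    using barycentric_coordinates[OF abc] by metis
  define bary where "bary \<alpha> \<beta> = \<alpha> *\<^sub>R a + \<beta> *\<^sub>R b + (1 - \<alpha> - \<beta>) *\<^sub>R c" for \<alpha> \<beta>
  \<comment> \<open>The barycentric coordinates are to be x - y, x + 2 y and 1 - 2 x - y, as in
    \<open>B\<close>; \<open>A\<close> solves for x and y. The reflections in \<open>s1\<close>,
    \<open>s2\<close>, \<open>s3\<close> thus fix the sides opposite a, b, c.\<close>
  define A where "A z = (complex_of_real ((2 * f1 z + f2 z) / 3), complex_of_real ((f2 z - f1 z) / 3))" for z
  define B where "B w = bary (Re (fst w - snd w)) (Re (fst w + 2 * snd w))" for w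
  define \<psi> where "\<psi> g z = B (g (A z))" for g :: "complex \<times> complex \<Rightarrow> _" and z
  have AR: "A z \<in> \<real> \<times> \<real>" for z
    by (simp add: A_def)
  have BA: "B (A z) = z" for z
  proof -
    have "Re (fst (A z) - snd (A z)) = f1 z" "Re (fst (A z) + 2 * snd (A z)) = f2 z"
      by (simp_all add: A_def field_simps)
    then show ?thesis
      using f[of z] by (simp add: B_def bary_def)
  qed
  have AB: "A (B w) = w" if w_real: "w \<in> \<real> \<times> \<real>" for w
  proof -
    obtain x y where w: "w = (complex_of_real x, complex_of_real y)"
      using w_real by (auto elim!: Reals_cases)
    have "f1 (B w) = x - y" "f2 (B w) = x + 2 * y"
      unfolding B_def bary_def f1 f2 by (simp_all add: w)
    then have "(2 * f1 (B w) + f2 (B w)) / 3 = x" "(f2 (B w) - f1 (B w)) / 3 = y" by simp_all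
    then show ?thesis
      unfolding A_def by (simp only: w)
  qed
  have AB': "\<forall>w\<in>\<real> \<times> \<real>. A (B w) = w" using AB by blast
  note emb = affine_weyl_embedding[where A = A and B = B, OF AR BA AB', folded \<psi>_def]
  have \<psi>_eq: "\<psi> g = r" if "\<And>\<alpha> \<beta>. B (g (of_real ((2 * \<alpha> + \<beta>) / 3), of_real ((\<beta> - \<alpha>) / 3))) = r (bary \<alpha> \<beta>)" for g r
  proof
    fix z
    show "\<psi> g z = r z"
      using that[of "f1 z" "f2 z"] f[of z] unfolding \<psi>_def A_def bary_def by simp
  qed
  have s1: "\<psi> (\<lambda>(x, y). (y, x)) = reflection_across (affine hull {b, c})"
  proof (rule \<psi>_eq)
    fix \<alpha> \<beta>
    have eq: "bary \<alpha> \<beta> = \<beta> *\<^sub>R b + (1 - \<alpha> - \<beta>) *\<^sub>R c + \<alpha> *\<^sub>R a"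
      by (simp add: bary_def)
    have "reflection_across (affine hull {b, c}) (bary \<alpha> \<beta>) = (\<beta> + \<alpha>) *\<^sub>R b + (1 - \<alpha> - \<beta> + \<alpha>) *\<^sub>R c - \<alpha> *\<^sub>R a"
      unfolding eq by (rule reflection_across_side[OF equilateral_rotate[OF abc]]) simp
    also have "\<dots> = bary (- \<alpha>) (\<alpha> + \<beta>)"
      by (simp add: bary_def add.commute)
    also have "\<dots> = B (case (of_real ((2 * \<alpha> + \<beta>) / 3), of_real ((\<beta> - \<alpha>) / 3)) of (x, y) \<Rightarrow> (y, x))"
      unfolding B_def by (rule arg_cong2[where f = bary]) (simp_all add: field_simps)
    finally show "B (case (of_real ((2 * \<alpha> + \<beta>) / 3), of_real ((\<beta> - \<alpha>) / 3)) of (x, y) \<Rightarrow> (y, x)) =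
      reflection_across (affine hull {b, c}) (bary \<alpha> \<beta>)" ..
  qed
  have s2: "\<psi> (\<lambda>(x, y). (x, - x - y)) = reflection_across (affine hull {c, a})"
  proof (rule \<psi>_eq)
    fix \<alpha> \<beta>
    have eq: "bary \<alpha> \<beta> = (1 - \<alpha> - \<beta>) *\<^sub>R c + \<alpha> *\<^sub>R a + \<beta> *\<^sub>R b"
      by (simp add: bary_def)
    have "reflection_across (affine hull {c, a}) (bary \<alpha> \<beta>) = (1 - \<alpha> - \<beta> + \<beta>) *\<^sub>R c + (\<alpha> + \<beta>) *\<^sub>R a - \<beta> *\<^sub>R b"
      unfolding eq by (rule reflection_across_side[OF equilateral_rotate[OF equilateral_rotate[OF abc]]]) simp
    also have "\<dots> = bary (\<alpha> + \<beta>) (- \<beta>)"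
      by (simp add: bary_def add.commute)
    also have "\<dots> = B (case (of_real ((2 * \<alpha> + \<beta>) / 3), of_real ((\<beta> - \<alpha>) / 3)) of (x, y) \<Rightarrow> (x, - x - y))"
      unfolding B_def by (rule arg_cong2[where f = bary]) (simp_all add: field_simps)
    finally show "B (case (of_real ((2 * \<alpha> + \<beta>) / 3), of_real ((\<beta> - \<alpha>) / 3)) of (x, y) \<Rightarrow> (x, - x - y)) =
      reflection_across (affine hull {c, a}) (bary \<alpha> \<beta>)" ..
  qed
  have s3: "\<psi> (\<lambda>(x, y). (1 - x - y, y)) = reflection_across (affine hull {a, b})"
  proof (rule \<psi>_eq)
    fix \<alpha> \<beta>
    have "reflection_across (affine hull {a, b}) (bary \<alpha> \<beta>) =
       (\<alpha> + (1 - \<alpha> - \<beta>)) *\<^sub>R a + (\<beta> + (1 - \<alpha> - \<beta>)) *\<^sub>R b - (1 - \<alpha> - \<beta>) *\<^sub>R c"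
      unfolding bary_def by (rule reflection_across_side[OF abc]) simp
    also have "\<dots> = bary (1 - \<beta>) (1 - \<alpha>)"
      by (simp add: bary_def scaleR_left_diff_distrib[symmetric]) (simp add: algebra_simps)
    also have "\<dots> = B (case (of_real ((2 * \<alpha> + \<beta>) / 3), of_real ((\<beta> - \<alpha>) / 3)) of (x, y) \<Rightarrow> (1 - x - y, y))"
      unfolding B_def by (rule arg_cong2[where f = bary]) (simp_all add: field_simps)
    finally show "B (case (of_real ((2 * \<alpha> + \<beta>) / 3), of_real ((\<beta> - \<alpha>) / 3)) of (x, y) \<Rightarrow> (1 - x - y, y)) =
      reflection_across (affine hull {a, b}) (bary \<alpha> \<beta>)" ..
  qed
  define R where "R = {reflection_across (affine hull {a, b}), reflection_across (affine hull {b, c}),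
       reflection_across (affine hull {c, a})}"
  have R: "R = \<psi> ` simple_reflections"
    unfolding R_def simple_reflections_def image_insert image_empty s1 s2 s3 by blast
  have RB: "R \<subseteq> carrier (BijGroup UNIV)"
    unfolding R using emb(3) simple_reflections_subset by (auto simp: BijGroup_UNIV_simps)
  have carrier: "carrier (triangle_reflection_group a b c) = generate (BijGroup UNIV) R"
    using RB by (simp add: triangle_reflection_group_def carrier_subgroup_generated R_def[symmetric] Int_absorb1)
  have "\<psi> ` affine_weyl = generate (BijGroup UNIV) R"
  proof
    show "generate (BijGroup UNIV) R \<subseteq> \<psi> ` affine_weyl"
      using group.generate_subgroup_incl[OF group_BijGroup _ emb(5)] simple_reflections_subset
      unfolding R by blast
    \<comment> \<open>The set is the preimage of the generated group under \<open>\<psi>\<close>,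
      kept inside \<open>affine_weyl\<close>, where \<open>\<psi>\<close> is multiplicative.\<close>
    have "affine_weyl \<subseteq> {g \<in> affine_weyl. \<psi> g \<in> generate (BijGroup UNIV) R}"
    proof (rule affine_weyl_generated)
      show "simple_reflections \<subseteq> {g \<in> affine_weyl. \<psi> g \<in> generate (BijGroup UNIV) R}"
        using simple_reflections_subset unfolding R by (blast intro: generate.incl)
      fix g h assume "g \<in> {g \<in> affine_weyl. \<psi> g \<in> generate (BijGroup UNIV) R}"
        "h \<in> {g \<in> affine_weyl. \<psi> g \<in> generate (BijGroup UNIV) R}"
      then have gh: "g \<in> affine_weyl" "\<psi> g \<in> generate (BijGroup UNIV) R"
        "h \<in> affine_weyl" "\<psi> h \<in> generate (BijGroup UNIV) R" by auto
      have "\<psi> (g \<circ> h) = \<psi> g \<otimes>\<^bsub>BijGroup UNIV\<^esub> \<psi> h"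
        using emb(1)[OF gh(1,3)] emb(3) gh by (simp add: BijGroup_UNIV_simps)
      then show "g \<circ> h \<in> {g \<in> affine_weyl. \<psi> g \<in> generate (BijGroup UNIV) R}"
        using gh affine_weyl_comp generate.eng by auto
    qed
    then show "\<psi> ` affine_weyl \<subseteq> generate (BijGroup UNIV) R" by blast
  qed
  then have image: "\<psi> ` affine_weyl = carrier (triangle_reflection_group a b c)"
    unfolding carrier .
  show ?thesis
    by (rule that[of \<psi>]) (fact emb(1-4) image)+
qed

theorem theorem2:
  fixes a b c :: "real^2"
  assumes "equilateral a b c"
  shows "iterated_monodromy_group deltoid_map (- deltoid) (0, 0) \<cong> triangle_reflection_group a b c"
proof -
  let ?G = "fundamental_group (- deltoid) (0, 0)"
  let ?T = "triangle_reflection_group a b c"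
  obtain \<psi> where comp: "\<And>g h. g \<in> affine_weyl \<Longrightarrow> h \<in> affine_weyl \<Longrightarrow> \<psi> (g \<circ> h) = \<psi> g \<circ> \<psi> h"
    and id: "\<psi> id = id" and bij: "\<And>g. g \<in> affine_weyl \<Longrightarrow> bij (\<psi> g)"
    and inj: "\<And>g. g \<in> affine_weyl \<Longrightarrow> \<psi> g = id \<Longrightarrow> g = id"
    and image: "\<psi> ` affine_weyl = carrier ?T"
    using affine_weyl_triangle[OF assms] by metis
  interpret deck: group_hom ?G "BijGroup UNIV" deltoid_cover.deck
    by (rule group_hom_deck)
  have T1: "group ?T"
    unfolding triangle_reflection_group_def by (rule group.group_subgroup_generated[OF group_BijGroup])
  have T: "\<one>\<^bsub>?T\<^esub> = id" "(\<otimes>\<^bsub>?T\<^esub>) = (\<otimes>\<^bsub>BijGroup UNIV\<^esub>)"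
    by (simp_all add: triangle_reflection_group_def subgroup_generated_def BijGroup_UNIV_simps)
  have W: "deltoid_cover.deck x \<in> affine_weyl" if "x \<in> carrier ?G" for x
    using deck_image that by blast
  interpret group_hom ?G ?T "\<psi> \<circ> deltoid_cover.deck"
  proof (rule group_hom.intro[OF deck.G.group_axioms T1], unfold group_hom_axioms_def, rule homI)
    fix x assume x: "x \<in> carrier ?G"
    show "(\<psi> \<circ> deltoid_cover.deck) x \<in> carrier ?T"
      using W[OF x] image by auto
    fix y assume y: "y \<in> carrier ?G"
    have "deltoid_cover.deck (x \<otimes>\<^bsub>?G\<^esub> y) = deltoid_cover.deck x \<circ> deltoid_cover.deck y"
      using deck.hom_mult[OF x y] deltoid_cover.bij_deck W x y by (simp add: BijGroup_UNIV_simps)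
    then show "(\<psi> \<circ> deltoid_cover.deck) (x \<otimes>\<^bsub>?G\<^esub> y) =
        (\<psi> \<circ> deltoid_cover.deck) x \<otimes>\<^bsub>?T\<^esub> (\<psi> \<circ> deltoid_cover.deck) y"
      using W[OF x] W[OF y] comp bij by (simp add: T(2) BijGroup_UNIV_simps)
  qed
  \<comment> \<open>By faithfulness of \<open>\<psi>\<close> the composite has the kernel of
    \<open>deck\<close>, so the first isomorphism theorem yields exactly the quotient that defines
    the iterated monodromy group.\<close>
  have "kernel ?G ?T (\<psi> \<circ> deltoid_cover.deck) = monodromy_kernel deltoid_map (- deltoid) (0, 0)"
    unfolding deltoid_monodromy_kernel kernel_def T(1) using inj id W by auto
  moreover have "(\<psi> \<circ> deltoid_cover.deck) ` carrier ?G = carrier ?T"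
    unfolding image_comp[symmetric] deck_image by (rule image)
  ultimately show ?thesis
    unfolding iterated_monodromy_group_def using FactGroup_iso by metis
qed

end
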